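(* Let $(X,\mathcal F)$ be a compact Polish foliated space of class $C^2$, and let $X_0\subset X$ be the union of the leaves without holonomy. With respect to an ergodic quasi-invariant current on $X$ for which $X\setminus X_0$ has zero measure, either (i) almost all leaves have the same growth type; or else (ii) the growth types of almost all leaves are comparable with the growth type of almost no leaf.
   Context: Foliated spaces. A foliated structure $\mathcal F$ of class $C^2$ and dimension $n$ on a space $X$ is given by an atlas $\{(U_i,\phi_i)\}$, where $\{U_i\}$ is an open cover of $X$ and $\phi_i:U_i\to B_i\times Z_i$ are homeomorphisms, with $B_i\subset\mathbb R^n$ an open ball and $Z_i$ a locally compact Polish space, whose changes of coordinates are locally of the form $\phi_j\phi_i^{-1}(x,z)=(x_{ij}(x,z),h_{ij}(z))$, where the partial derivatives of $x_{ij}$ up to order $2$ with respect to $x$ exist and are continuous in $(x,z)$. The sets $\phi_i^{-1}(B_i\times\{z\})$ are the plaques; the leaves are the connected components of $X$ with the topology whose basic open sets are the plaques of all foliated charts. $L_x$ is the leaf through $x$. $(X,\mathcal F)$ is compact Polish if $X$ is compact, Hausdorff and second countable. A subset is saturated if it is a union of leaves. Regular atlas and holonomy. A foliated atlas $\mathcal U=\{(U_i,\phi_i)\}$ is regular if: each $(U_i,\phi_i)$ is the restriction of a foliated chart $(\widetilde U_i,\tilde\phi_i)$ with $\overline{U_i}\subset\widetilde U_i$; $\{U_i\}$ is locally finite; and the closure of every plaque of $(U_i,\phi_i)$ meets at most the closure of one plaque of $(U_j,\phi_j)$, for all $i,j$. Let $p_i:U_i\to Z_i$ be $\phi_i$ followed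 by the second projection; there are homeomorphisms $h_{ij}:p_i(U_i\cap U_j)\to p_j(U_i\cap U_j)$ with $p_j=h_{ij}p_i$ on $U_i\cap U_j$, generating the holonomy pseudogroup $\mathcal H$ on $\bigsqcup_iZ_i$. The holonomy group of the leaf through $x\in U_i$ is the group of germs at $p_i(x)$ of maps in $\mathcal H$ fixing $p_i(x)$; a leaf is without holonomy if this group is trivial. Growth. Fix a regular foliated atlas $\mathcal U$. For $x,y$ in the same leaf, $d^*_{\mathcal U}(x,y)=0$ if $x=y$, and otherwise it is the minimum number of $\mathcal U$-plaques whose union is connected and contains $x$ and $y$. For $x\in X$ and $r>0$, $v_{\mathcal U}(x,r)$ is the number of $\mathcal U$-plaques that meet the ball of center $x$ and radius $r$ in $(L_x,d^*_{\mathcal U})$. For non-decreasing functions $u,v:\mathbb R^+\to\mathbb R^+$, $u$ is dominated by $v$ if there are $a,b\ge1$ and $c>0$ with $u(r)\le a\,v(br)$ for all $r\ge c$; $u$ and $v$ have the same growth type if each is dominated by the other. Domination induces a partial order on growth types, and two growth types are comparable if one of them dominates the other. The growth type of a leaf $L$ is the growth type of $r\mapsto v_{\mathcal U}(x,r)$ for any $x\in L$; it is independent of $x$ and $\mathcal U$. Quasi-invariant currents. A current $m$ on $(X,\mathcal F)$ is a positive linear functional on the space of compactly supported (leafwise) densities, i.e. sections of the bundle of densities of the leafwise tangent bundle; choosing a positive density, it is identified with a Radon measure on $X$ whose sets of zero measure do not depend on the choice. It is quasi-invariant if, on each foliated chart $\phi:U\to B\times Z$, $\phi_*m$ admits a disintegration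 $\phi_*m=\int_Z\lambda_z\cdot\mu_Z(z)$, where $\mu_Z$ is a measure on $Z$ and, for $\mu_Z$-almost all $z\in Z$, $\lambda_z$ is equivalent to the Lebesgue current on $B\times\{z\}$ (same sets of zero measure). It is ergodic if every saturated measurable set has either zero measure or full measure (complement of zero measure). A property holds for almost all (respectively, almost no) leaves if the set of $x\in X$ such that $L_x$ satisfies it has full (respectively, zero) measure. Thus (ii) means that, for almost every $x\in X$, the set of $y\in X$ such that the growth types of $L_x$ and $L_y$ are comparable has zero measure. *)

theory Defs
  imports "HOL-Analysis.Analysis"
begin

section \<open>Foliated spaces\<close>

text \<open>
  The ambient space \<open>X\<close> is the type \<open>'a\<close>.  A chart \<open>\<phi> : U \<rightarrow> B \<times> Z\<close> consists of the set \<open>U\<close>, the map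
  \<open>\<phi>\<close> (relevant on \<open>U\<close> only), the ball \<open>B\<close> and the transversal \<open>Z\<close>, a topological space whose points
  are taken from the type \<open>'z\<close>.
\<close>

record ('a, 'e, 'z) chart =
  chart_dom :: "'a set"
  chart_map :: "'a \<Rightarrow> 'e \<times> 'z"
  chart_ball :: "'e set"
  chart_trans :: "'z topology"

definition polish_topology :: "'z topology \<Rightarrow> bool" where
  "polish_topology Z \<longleftrightarrow> completely_metrizable_space Z \<and> second_countable Z"

definition is_chart :: "('a::topological_space, real^'n, 'z) chart \<Rightarrow> bool" where
  "is_chart C \<longleftrightarrow>
     open (chart_dom C) \<and>
     (\<exists>c r. r > 0 \<and> chart_ball C = ball c r) \<and>
     polish_topology (chart_trans C) \<and> locally_compact_space (chart_trans C) \<and>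
     homeomorphic_map (top_of_set (chart_dom C))
       (prod_topology (top_of_set (chart_ball C)) (chart_trans C)) (chart_map C)"

definition chart_inv :: "('a, 'e, 'z) chart \<Rightarrow> 'e \<times> 'z \<Rightarrow> 'a" where
  "chart_inv C = inv_into (chart_dom C) (chart_map C)"

definition transition :: "('a, 'e, 'z) chart \<Rightarrow> ('a, 'e, 'z) chart \<Rightarrow> 'e \<times> 'z \<Rightarrow> 'e \<times> 'z" where
  "transition C D = chart_map D \<circ> chart_inv C"

text \<open>The partial derivatives with respect to \<open>x\<close> of \<open>f (x, z)\<close> up to order \<open>k\<close> exist on \<open>V \<times> Z\<close>
  and are continuous in \<open>(x, z)\<close>; here \<open>V\<close> is meant to be open.\<close>

primrec leafwise_C ::
  "nat \<Rightarrow> 'e::euclidean_space set \<Rightarrow> 'z topology \<Rightarrow> ('e \<times> 'z \<Rightarrow> 'f::real_normed_vector) \<Rightarrow> bool" where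
  "leafwise_C 0 V Z f \<longleftrightarrow> continuous_map (prod_topology (top_of_set V) Z) euclidean f"
| "leafwise_C (Suc k) V Z f \<longleftrightarrow>
     continuous_map (prod_topology (top_of_set V) Z) euclidean f \<and>
     (\<forall>b\<in>Basis. \<exists>g. leafwise_C k V Z g \<and>
        (\<forall>x\<in>V. \<forall>z\<in>topspace Z.
           ((\<lambda>t. f (x + t *\<^sub>R b, z)) has_vector_derivative g (x, z)) (at 0)))"

definition C2_compatible ::
  "('a, real^'n, 'z) chart \<Rightarrow> ('a, real^'n, 'z) chart \<Rightarrow> bool" where
  "C2_compatible C D \<longleftrightarrow>
     (\<forall>p \<in> chart_dom C \<inter> chart_dom D. \<exists>V T h.
        open V \<and> openin (chart_trans C) T \<and> chart_map C p \<in> V \<times> T \<and>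
        V \<times> T \<subseteq> chart_map C ` (chart_dom C \<inter> chart_dom D) \<and>
        (\<forall>x\<in>V. \<forall>z\<in>T. snd (transition C D (x, z)) = h z) \<and>
        leafwise_C 2 V (subtopology (chart_trans C) T) (fst \<circ> transition C D))"

definition foliated_atlas :: "('a::topological_space, real^'n, 'z) chart set \<Rightarrow> bool" where
  "foliated_atlas \<A> \<longleftrightarrow>
     (\<forall>C\<in>\<A>. is_chart C) \<and> (\<Union>C\<in>\<A>. chart_dom C) = UNIV \<and>
     (\<forall>C\<in>\<A>. \<forall>D\<in>\<A>. C2_compatible C D)"

text \<open>The foliated charts (with transversal in \<open>'z\<close>) of the foliated structure given by the atlas
  \<open>\<A>\<close>, i.e. the maximal atlas containing \<open>\<A>\<close>.\<close>

definition foliated_charts ::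
  "('a::topological_space, real^'n, 'z) chart set \<Rightarrow> ('a, real^'n, 'z) chart set" where
  "foliated_charts \<A> = {C. is_chart C \<and> (\<forall>D\<in>\<A>. C2_compatible C D \<and> C2_compatible D C)}"

definition trans_proj :: "('a, 'e, 'z) chart \<Rightarrow> 'a \<Rightarrow> 'z" where
  "trans_proj C p = snd (chart_map C p)"

definition plaques :: "('a, 'e, 'z) chart \<Rightarrow> 'a set set" where
  "plaques C = (\<lambda>z. {p \<in> chart_dom C. trans_proj C p = z}) ` topspace (chart_trans C)"

definition leaf_topology :: "('a::topological_space, real^'n, 'z) chart set \<Rightarrow> 'a topology" where
  "leaf_topology \<A> = topology_generated_by (\<Union>C\<in>foliated_charts \<A>. plaques C)"

definition leaves :: "('a::topological_space, real^'n, 'z) chart set \<Rightarrow> 'a set set" where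
  "leaves \<A> = connected_components_of (leaf_topology \<A>)"

definition leaf :: "('a::topological_space, real^'n, 'z) chart set \<Rightarrow> 'a \<Rightarrow> 'a set" where
  "leaf \<A> x = connected_component_of_set (leaf_topology \<A>) x"

definition saturated :: "('a::topological_space, real^'n, 'z) chart set \<Rightarrow> 'a set \<Rightarrow> bool" where
  "saturated \<A> A \<longleftrightarrow> (\<exists>\<S> \<subseteq> leaves \<A>. A = \<Union>\<S>)"

section \<open>Regular atlases and holonomy\<close>

definition chart_restriction :: "('a, 'e, 'z) chart \<Rightarrow> ('a, 'e, 'z) chart \<Rightarrow> bool" where
  "chart_restriction C D \<longleftrightarrow>
     chart_dom C \<subseteq> chart_dom D \<and> (\<forall>p\<in>chart_dom C. chart_map C p = chart_map D p)"

definition regular_atlas ::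
  "('a::topological_space, real^'n, 'z) chart set \<Rightarrow> ('a, real^'n, 'z) chart set \<Rightarrow> bool" where
  "regular_atlas \<A> \<U> \<longleftrightarrow>
     \<U> \<subseteq> foliated_charts \<A> \<and> (\<Union>C\<in>\<U>. chart_dom C) = UNIV \<and>
     (\<forall>C\<in>\<U>. \<exists>D\<in>foliated_charts \<A>. chart_restriction C D \<and> closure (chart_dom C) \<subseteq> chart_dom D) \<and>
     (\<forall>p. \<exists>N. open N \<and> p \<in> N \<and> finite {C\<in>\<U>. chart_dom C \<inter> N \<noteq> {}}) \<and>
     (\<forall>C\<in>\<U>. \<forall>D\<in>\<U>. \<forall>P\<in>plaques C. \<forall>Q\<in>plaques D. \<forall>Q'\<in>plaques D.
        closure P \<inter> closure Q \<noteq> {} \<longrightarrow> closure P \<inter> closure Q' \<noteq> {} \<longrightarrow> Q = Q')"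

definition local_homeomorphism :: "'b topology \<Rightarrow> ('b \<rightharpoonup> 'b) \<Rightarrow> bool" where
  "local_homeomorphism T f \<longleftrightarrow>
     openin T (dom f) \<and> openin T (ran f) \<and>
     homeomorphic_map (subtopology T (dom f)) (subtopology T (ran f)) (the \<circ> f)"

text \<open>The pseudogroup generated by a set \<open>G\<close> of homeomorphisms between open subsets of \<open>T\<close>: closed
  under composition, inversion, restriction to open sets and combination.\<close>

inductive_set generated_pseudogroup :: "'b topology \<Rightarrow> ('b \<rightharpoonup> 'b) set \<Rightarrow> ('b \<rightharpoonup> 'b) set"
  for T :: "'b topology" and G :: "('b \<rightharpoonup> 'b) set" where
  generator: "f \<in> G \<Longrightarrow> f \<in> generated_pseudogroup T G"
| identity: "Some |` topspace T \<in> generated_pseudogroup T G"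
| composition: "f \<in> generated_pseudogroup T G \<Longrightarrow> g \<in> generated_pseudogroup T G \<Longrightarrow>
    f \<circ>\<^sub>m g \<in> generated_pseudogroup T G"
| inversion: "f \<in> generated_pseudogroup T G \<Longrightarrow> (\<And>x y. g y = Some x \<longleftrightarrow> f x = Some y) \<Longrightarrow>
    g \<in> generated_pseudogroup T G"
| restriction: "f \<in> generated_pseudogroup T G \<Longrightarrow> openin T U \<Longrightarrow>
    f |` U \<in> generated_pseudogroup T G"
| combination: "local_homeomorphism T f \<Longrightarrow>
    (\<And>x. x \<in> dom f \<Longrightarrow> \<exists>U. openin T U \<and> x \<in> U \<and> f |` U \<in> generated_pseudogroup T G) \<Longrightarrow>
    f \<in> generated_pseudogroup T G"

text \<open>The map \<open>h\<^bsub>CD\<^esub>\<close> with \<open>p\<^sub>D = h\<^bsub>CD\<^esub> \<circ> p\<^sub>C\<close> on \<open>U\<^sub>C \<inter> U\<^sub>D\<close>; regularity makes it well defined.\<close>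

definition holonomy_map :: "('a, 'e, 'z) chart \<Rightarrow> ('a, 'e, 'z) chart \<Rightarrow> ('z \<rightharpoonup> 'z)" where
  "holonomy_map C D z =
     (if z \<in> trans_proj C ` (chart_dom C \<inter> chart_dom D)
      then Some (THE w. \<exists>p \<in> chart_dom C \<inter> chart_dom D. trans_proj C p = z \<and> trans_proj D p = w)
      else None)"

definition total_transversal ::
  "('a, 'e, 'z) chart set \<Rightarrow> (('a, 'e, 'z) chart \<times> 'z) topology" where
  "total_transversal \<U> = sum_topology chart_trans \<U>"

definition holonomy_pseudogroup ::
  "('a, 'e, 'z) chart set \<Rightarrow> (('a, 'e, 'z) chart \<times> 'z \<rightharpoonup> ('a, 'e, 'z) chart \<times> 'z) set" where
  "holonomy_pseudogroup \<U> = generated_pseudogroup (total_transversal \<U>)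
     {(\<lambda>(C', z). if C' = C then map_option (Pair D) (holonomy_map C D z) else None)
      | C D. C \<in> \<U> \<and> D \<in> \<U>}"

definition germ :: "'b topology \<Rightarrow> 'b \<Rightarrow> ('b \<rightharpoonup> 'b) \<Rightarrow> ('b \<rightharpoonup> 'b) set" where
  "germ T y f = {g. \<exists>U. openin T U \<and> y \<in> U \<and> g |` U = f |` U}"

definition holonomy_group ::
  "('a, 'e, 'z) chart set \<Rightarrow> ('a, 'e, 'z) chart \<times> 'z
    \<Rightarrow> (('a, 'e, 'z) chart \<times> 'z \<rightharpoonup> ('a, 'e, 'z) chart \<times> 'z) set set" where
  "holonomy_group \<U> y =
     germ (total_transversal \<U>) y ` {f \<in> holonomy_pseudogroup \<U>. f y = Some y}"

definition without_holonomy :: "('a, 'e, 'z) chart set \<Rightarrow> 'a set \<Rightarrow> bool" where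
  "without_holonomy \<U> L \<longleftrightarrow>
     (\<forall>x\<in>L. \<forall>C\<in>\<U>. x \<in> chart_dom C \<longrightarrow>
        holonomy_group \<U> (C, trans_proj C x) =
          {germ (total_transversal \<U>) (C, trans_proj C x) Some})"

definition holonomy_free_part ::
  "('a::topological_space, real^'n, 'z) chart set \<Rightarrow> ('a, real^'n, 'z) chart set \<Rightarrow> 'a set" where
  "holonomy_free_part \<A> \<U> = \<Union>{L \<in> leaves \<A>. without_holonomy \<U> L}"

section \<open>Growth\<close>

text \<open>Connectedness of a union of plaques refers to the leaf topology.  The distance is meaningful
  only for points of the same leaf.\<close>

definition plaque_dist ::
  "('a::topological_space, real^'n, 'z) chart set \<Rightarrow> ('a, real^'n, 'z) chart set \<Rightarrow> 'a \<Rightarrow> 'a \<Rightarrow> nat"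
  where
  "plaque_dist \<A> \<U> x y =
     (if x = y then 0
      else LEAST k. \<exists>\<P> \<subseteq> (\<Union>C\<in>\<U>. plaques C).
        finite \<P> \<and> card \<P> = k \<and> connectedin (leaf_topology \<A>) (\<Union>\<P>) \<and> x \<in> \<Union>\<P> \<and> y \<in> \<Union>\<P>)"

definition plaque_growth ::
  "('a::topological_space, real^'n, 'z) chart set \<Rightarrow> ('a, real^'n, 'z) chart set
    \<Rightarrow> 'a \<Rightarrow> real \<Rightarrow> real" where
  "plaque_growth \<A> \<U> x r =
     real (card {P \<in> (\<Union>C\<in>\<U>. plaques C).
       P \<inter> {y \<in> leaf \<A> x. real (plaque_dist \<A> \<U> x y) < r} \<noteq> {}})"

definition dominated :: "(real \<Rightarrow> real) \<Rightarrow> (real \<Rightarrow> real) \<Rightarrow> bool" where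
  "dominated u v \<longleftrightarrow> (\<exists>a b c. a \<ge> 1 \<and> b \<ge> 1 \<and> c > 0 \<and> (\<forall>r\<ge>c. u r \<le> a * v (b * r)))"

definition same_growth_type :: "(real \<Rightarrow> real) \<Rightarrow> (real \<Rightarrow> real) \<Rightarrow> bool" where
  "same_growth_type u v \<longleftrightarrow> dominated u v \<and> dominated v u"

definition comparable_growth_types :: "(real \<Rightarrow> real) \<Rightarrow> (real \<Rightarrow> real) \<Rightarrow> bool" where
  "comparable_growth_types u v \<longleftrightarrow> dominated u v \<or> dominated v u"

section \<open>Leafwise densities and currents\<close>

text \<open>
  A section \<open>\<eta>\<close> of the leafwise density bundle is given by its coefficient functions in the foliated
  charts, \<open>\<eta> = \<eta>\<^sub>C \<bar>dx\<^sub>C\<bar>\<close> on \<open>U\<^sub>C\<close>, which change by the absolute value of the leafwise Jacobian.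
  The coefficients are set to zero where they have no meaning, so that distinct functions are
  distinct sections.
\<close>

type_synonym ('a, 'n, 'z) leafwise_section = "('a, real^'n, 'z) chart \<Rightarrow> 'a \<Rightarrow> real"

definition leafwise_jacobian ::
  "('a, real^'n, 'z) chart \<Rightarrow> ('a, real^'n, 'z) chart \<Rightarrow> 'a \<Rightarrow> real" where
  "leafwise_jacobian C D p =
     det (matrix (frechet_derivative (\<lambda>x. fst (transition C D (x, trans_proj C p)))
                    (at (fst (chart_map C p)))))"

definition leafwise_density ::
  "('a::topological_space, real^'n, 'z) chart set \<Rightarrow> ('a, 'n, 'z) leafwise_section \<Rightarrow> bool" where
  "leafwise_density \<A> \<eta> \<longleftrightarrow>
     (\<forall>C p. C \<notin> foliated_charts \<A> \<or> p \<notin> chart_dom C \<longrightarrow> \<eta> C p = 0) \<and>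
     (\<forall>C\<in>foliated_charts \<A>. continuous_on (chart_dom C) (\<eta> C)) \<and>
     (\<forall>C\<in>foliated_charts \<A>. \<forall>D\<in>foliated_charts \<A>. \<forall>p \<in> chart_dom C \<inter> chart_dom D.
        \<eta> C p = \<bar>leafwise_jacobian C D p\<bar> * \<eta> D p)"

definition section_support :: "('a::topological_space, 'n, 'z) leafwise_section \<Rightarrow> 'a set" where
  "section_support \<eta> = closure {p. \<exists>C. \<eta> C p \<noteq> 0}"

definition compact_densities ::
  "('a::topological_space, real^'n, 'z) chart set \<Rightarrow> ('a, 'n, 'z) leafwise_section set" where
  "compact_densities \<A> = {\<eta>. leafwise_density \<A> \<eta> \<and> compact (section_support \<eta>)}"

definition positive_density ::
  "('a::topological_space, real^'n, 'z) chart set \<Rightarrow> ('a, 'n, 'z) leafwise_section \<Rightarrow> bool" where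
  "positive_density \<A> \<omega> \<longleftrightarrow>
     leafwise_density \<A> \<omega> \<and> (\<forall>C\<in>foliated_charts \<A>. \<forall>p\<in>chart_dom C. \<omega> C p > 0)"

definition current ::
  "('a::topological_space, real^'n, 'z) chart set
    \<Rightarrow> (('a, 'n, 'z) leafwise_section \<Rightarrow> real) \<Rightarrow> bool" where
  "current \<A> m \<longleftrightarrow>
     (\<forall>\<eta>\<in>compact_densities \<A>. \<forall>\<theta>\<in>compact_densities \<A>.
        m (\<lambda>C p. \<eta> C p + \<theta> C p) = m \<eta> + m \<theta>) \<and>
     (\<forall>c. \<forall>\<eta>\<in>compact_densities \<A>. m (\<lambda>C p. c * \<eta> C p) = c * m \<eta>) \<and>
     (\<forall>\<eta>\<in>compact_densities \<A>. (\<forall>C p. \<eta> C p \<ge> 0) \<longrightarrow> m \<eta> \<ge> 0)"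

text \<open>\<open>M\<close> is the Radon measure identified with the current \<open>m\<close> by means of the positive density \<open>\<omega>\<close>.
  On the second countable, locally compact Hausdorff spaces considered here, regularity of a Borel
  measure follows from finiteness on compact sets.\<close>

definition represents_current ::
  "('a::topological_space, real^'n, 'z) chart set \<Rightarrow> (('a, 'n, 'z) leafwise_section \<Rightarrow> real)
    \<Rightarrow> ('a, 'n, 'z) leafwise_section \<Rightarrow> 'a measure \<Rightarrow> bool" where
  "represents_current \<A> m \<omega> M \<longleftrightarrow>
     sets M = sets borel \<and> (\<forall>K. compact K \<longrightarrow> emeasure M K < \<infinity>) \<and>
     (\<forall>f. continuous_on UNIV f \<longrightarrow> compact (closure {p. f p \<noteq> 0}) \<longrightarrow>
        m (\<lambda>C p. f p * \<omega> C p) = (\<integral>p. f p \<partial>M))"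

text \<open>
  In a chart \<open>C\<close>, a current on \<open>B \<times> {z}\<close> is identified, by means of the density \<open>\<bar>dx\<^sub>C\<bar>\<close>, with a Radon
  measure \<open>\<lambda> z\<close> on \<open>B\<close>; the Lebesgue current becomes Lebesgue measure.  The displayed integral is the
  disintegration of \<open>m\<close> restricted to the densities with compact support in \<open>U\<^sub>C\<close>.
\<close>

definition disintegrates ::
  "('a::topological_space, real^'n, 'z) chart set \<Rightarrow> (('a, 'n, 'z) leafwise_section \<Rightarrow> real)
    \<Rightarrow> ('a, real^'n, 'z) chart \<Rightarrow> 'z measure \<Rightarrow> ('z \<Rightarrow> (real^'n) measure) \<Rightarrow> bool" where
  "disintegrates \<A> m C \<mu> \<Lambda> \<longleftrightarrow>
     space \<mu> = topspace (chart_trans C) \<and>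
     sets \<mu> = sigma_sets (topspace (chart_trans C)) {T. openin (chart_trans C) T} \<and>
     (\<forall>z\<in>topspace (chart_trans C).
        sets (\<Lambda> z) = sets (restrict_space borel (chart_ball C)) \<and>
        (\<forall>K. compact K \<and> K \<subseteq> chart_ball C \<longrightarrow> emeasure (\<Lambda> z) K < \<infinity>)) \<and>
     (\<forall>\<eta>\<in>compact_densities \<A>. section_support \<eta> \<subseteq> chart_dom C \<longrightarrow>
        has_bochner_integral \<mu> (\<lambda>z. \<integral>x. \<eta> C (chart_inv C (x, z)) \<partial>\<Lambda> z) (m \<eta>))"

definition quasi_invariant ::
  "('a::topological_space, real^'n, 'z) chart set
    \<Rightarrow> (('a, 'n, 'z) leafwise_section \<Rightarrow> real) \<Rightarrow> bool" where
  "quasi_invariant \<A> m \<longleftrightarrow>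
     (\<forall>C\<in>foliated_charts \<A>. \<exists>\<mu> \<Lambda>. disintegrates \<A> m C \<mu> \<Lambda> \<and>
        (AE z in \<mu>. null_sets (\<Lambda> z) = null_sets (restrict_space lborel (chart_ball C))))"

definition ergodic :: "('a::topological_space, real^'n, 'z) chart set \<Rightarrow> 'a measure \<Rightarrow> bool" where
  "ergodic \<A> M \<longleftrightarrow>
     (\<forall>A\<in>sets M. saturated \<A> A \<longrightarrow> emeasure M A = 0 \<or> emeasure M (space M - A) = 0)"

end

theory Submission
  imports Defs
begin

text \<open>
  The points at plaque distance at most \<open>k\<close> from \<open>x\<close> are those reached from \<open>x\<close> in \<open>k\<close> steps of the
  relation "lying in a common plaque".  Since the projection of a chart onto its transversal is open,
  the points from which an open set is reached in \<open>k\<close> steps form an open set; since the transversals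
  are Hausdorff, distinct plaques reached from \<open>x\<close> persist near \<open>x\<close>.  Hence, for each chart, the number
  of its plaques meeting the ball of radius \<open>k\<close> is a lower semicontinuous function of the centre.  The
  sum of these numbers over the finitely many charts is the plaque growth up to a bounded factor,
  because one plaque may belong to several charts.  So domination of growth types is a measurable
  preorder, invariant under the leaf relation.  By ergodicity its sections are null or conull, and by
  Fubini's theorem almost every \<open>x\<close> is dominated by almost every \<open>y\<close> if and only if almost every \<open>x\<close>
  dominates almost every \<open>y\<close>; the two cases are the two alternatives.
\<close>

section \<open>Foliated charts, their transversal projections and plaques\<close>

lemma chart_continuous_map:
  assumes "is_chart C"
  shows "continuous_map (top_of_set (chart_dom C))
           (prod_topology (top_of_set (chart_ball C)) (chart_trans C)) (chart_map C)"
  using assms homeomorphic_imp_continuous_map unfolding is_chart_def by blast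

lemma chart_map_inj_on: "is_chart C \<Longrightarrow> inj_on (chart_map C) (chart_dom C)"
  using homeomorphic_imp_injective_map unfolding is_chart_def by fastforce

lemma chart_map_image:
  "is_chart C \<Longrightarrow> chart_map C ` chart_dom C = chart_ball C \<times> topspace (chart_trans C)"
  using homeomorphic_imp_surjective_map unfolding is_chart_def by fastforce

lemma chart_inv_chart_map [simp]:
  "is_chart C \<Longrightarrow> p \<in> chart_dom C \<Longrightarrow> chart_inv C (chart_map C p) = p"
  by (simp add: chart_inv_def chart_map_inj_on)

lemma chart_map_chart_inv:
  assumes "is_chart C" "x \<in> chart_ball C" "z \<in> topspace (chart_trans C)"
  shows "chart_inv C (x, z) \<in> chart_dom C" "chart_map C (chart_inv C (x, z)) = (x, z)"
proof -
  have "(x, z) \<in> chart_map C ` chart_dom C"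
    using assms chart_map_image by blast
  then show "chart_inv C (x, z) \<in> chart_dom C" "chart_map C (chart_inv C (x, z)) = (x, z)"
    by (simp_all add: chart_inv_def inv_into_into f_inv_into_f)
qed

lemma continuous_map_trans_proj:
  assumes "is_chart C"
  shows "continuous_map (top_of_set (chart_dom C)) (chart_trans C) (trans_proj C)"
proof -
  have "trans_proj C = snd \<circ> chart_map C"
    by (auto simp: trans_proj_def)
  then show ?thesis
    using continuous_map_compose[OF chart_continuous_map[OF assms] continuous_map_snd] by simp
qed

lemma trans_proj_in_topspace:
  "is_chart C \<Longrightarrow> p \<in> chart_dom C \<Longrightarrow> trans_proj C p \<in> topspace (chart_trans C)"
  using continuous_map_image_subset_topspace[OF continuous_map_trans_proj] by fastforce

lemma open_trans_proj_vimage: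
  assumes "is_chart C" "openin (chart_trans C) T"
  shows "open {p \<in> chart_dom C. trans_proj C p \<in> T}"
proof -
  have "openin (top_of_set (chart_dom C)) {p \<in> chart_dom C. trans_proj C p \<in> T}"
    using openin_continuous_map_preimage[OF continuous_map_trans_proj[OF assms(1)] assms(2)] by simp
  then show ?thesis
    using assms(1) by (simp add: is_chart_def openin_open_eq)
qed

text \<open>The set is the preimage under \<open>trans_proj C\<close> of the image of
  \<open>W\<close>, and that image is open because the second projection of a product is an open
  map.\<close>

lemma open_chart_saturation:
  assumes "is_chart C" "open W"
  shows "open {p \<in> chart_dom C. \<exists>q \<in> W \<inter> chart_dom C. trans_proj C p = trans_proj C q}"
proof -
  have "openin (top_of_set (chart_dom C)) (W \<inter> chart_dom C)"
    using assms(2) by (metis inf_commute openin_open_Int)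
  then have "openin (prod_topology (top_of_set (chart_ball C)) (chart_trans C))
      (chart_map C ` (W \<inter> chart_dom C))"
    using assms(1) homeomorphic_imp_open_map unfolding is_chart_def open_map_def by blast
  then have "openin (chart_trans C) (snd ` chart_map C ` (W \<inter> chart_dom C))"
    using open_map_snd unfolding open_map_def by blast
  then have "open {p \<in> chart_dom C. trans_proj C p \<in> snd ` chart_map C ` (W \<inter> chart_dom C)}"
    by (rule open_trans_proj_vimage[OF assms(1)])
  moreover have "snd ` chart_map C ` (W \<inter> chart_dom C) = trans_proj C ` (W \<inter> chart_dom C)"
    by (auto simp: trans_proj_def image_image)
  ultimately show ?thesis
    by (simp add: image_iff)
qed

lemma plaque_through:
  "is_chart C \<Longrightarrow> p \<in> chart_dom C \<Longrightarrow>
    {q \<in> chart_dom C. trans_proj C q = trans_proj C p} \<in> plaques C"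
  by (auto simp: plaques_def trans_proj_in_topspace)

lemma plaques_nonempty:
  assumes "is_chart C" "P \<in> plaques C"
  shows "P \<noteq> {}"
proof -
  obtain z where z: "z \<in> topspace (chart_trans C)" "P = {p \<in> chart_dom C. trans_proj C p = z}"
    using assms(2) by (auto simp: plaques_def)
  obtain c r where "r > 0" "chart_ball C = ball c r"
    using assms(1) by (auto simp: is_chart_def)
  then have "c \<in> chart_ball C" by simp
  from chart_map_chart_inv[OF assms(1) this z(1)] have "chart_inv C (c, z) \<in> P"
    by (simp add: z(2) trans_proj_def)
  then show ?thesis by blast
qed

section \<open>Changes of charts and the leaf topology\<close>

text \<open>The neighbourhood is the preimage of a box \<open>V \<times> T\<close> on which the
  transversal part of the transition is a function \<open>h\<close> of \<open>z\<close>
  alone.\<close>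

lemma C2_compatible_locally_constant:
  assumes "is_chart C" "is_chart D" "C2_compatible C D" "p \<in> chart_dom C" "p \<in> chart_dom D"
  obtains N where "open N" "p \<in> N" "N \<subseteq> chart_dom C \<inter> chart_dom D"
    "\<And>q q'. q \<in> N \<Longrightarrow> q' \<in> N \<Longrightarrow> trans_proj C q = trans_proj C q' \<Longrightarrow>
       trans_proj D q = trans_proj D q'"
proof -
  have "p \<in> chart_dom C \<inter> chart_dom D"
    using assms(4,5) by blast
  from bspec[OF assms(3)[unfolded C2_compatible_def] this]
  obtain V T h where V: "open V" and T: "openin (chart_trans C) T"
    and p: "chart_map C p \<in> V \<times> T"
    and sub: "V \<times> T \<subseteq> chart_map C ` (chart_dom C \<inter> chart_dom D)"
    and h: "\<forall>x\<in>V. \<forall>z\<in>T. snd (transition C D (x, z)) = h z"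
    by (elim exE conjE) (rule that)
  define N where "N = {q \<in> chart_dom C. chart_map C q \<in> V \<times> T}"
  \<comment> \<open>\<open>V\<close> is given as open in Euclidean space; cutting it down to the
    ball exhibits the same box as open in the product topology.\<close>
  have "V \<times> T = (V \<inter> chart_ball C) \<times> T"
    using sub chart_map_image[OF assms(1)] by blast
  moreover have "openin (top_of_set (chart_ball C)) (V \<inter> chart_ball C)"
    using V by (metis inf_commute openin_open_Int)
  ultimately have "openin (prod_topology (top_of_set (chart_ball C)) (chart_trans C)) (V \<times> T)"
    using T by (metis openin_prod_Times_iff)
  from openin_continuous_map_preimage[OF chart_continuous_map[OF assms(1)] this]
  have "open N"
    using assms(1) by (simp add: N_def is_chart_def openin_open_eq)
  moreover have "N \<subseteq> chart_dom C \<inter> chart_dom D"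
  proof
    fix q assume "q \<in> N"
    then have q: "q \<in> chart_dom C" "chart_map C q \<in> V \<times> T"
      by (simp_all add: N_def)
    then obtain q' where "q' \<in> chart_dom C \<inter> chart_dom D" "chart_map C q = chart_map C q'"
      using sub by (meson imageE subsetD)
    then show "q \<in> chart_dom C \<inter> chart_dom D"
      using inj_onD[OF chart_map_inj_on[OF assms(1)]] q(1) by (metis IntD1)
  qed
  moreover have "trans_proj D q = h (trans_proj C q)" if "q \<in> N" for q
  proof -
    have "chart_map C q \<in> V \<times> T" "q \<in> chart_dom C"
      using that by (auto simp: N_def)
    then have "snd (transition C D (chart_map C q)) = h (snd (chart_map C q))"
      using h by (metis mem_Sigma_iff prod.collapse)
    then show ?thesis
      using assms(1) \<open>q \<in> chart_dom C\<close> by (simp add: transition_def trans_proj_def)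
  qed
  ultimately show thesis
    using that[of N] p assms(4) by (simp add: N_def)
qed

text \<open>Members of \<open>foliated_charts \<A>\<close> are by definition compatible with the
  charts of \<open>\<A>\<close>, not with each other, so the passage from \<open>C\<close> to
  \<open>D\<close> goes through a chart \<open>E\<close> of \<open>\<A>\<close> around
  \<open>p\<close>.\<close>

lemma foliated_charts_locally_constant:
  assumes "foliated_atlas \<A>" "C \<in> foliated_charts \<A>" "D \<in> foliated_charts \<A>"
    and "p \<in> chart_dom C" "p \<in> chart_dom D"
  obtains N where "open N" "p \<in> N" "N \<subseteq> chart_dom C \<inter> chart_dom D"
    "\<And>q. q \<in> N \<Longrightarrow> trans_proj C q = trans_proj C p \<Longrightarrow> trans_proj D q = trans_proj D p"
proof -
  obtain E where E: "E \<in> \<A>" "p \<in> chart_dom E"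
    using assms(1) unfolding foliated_atlas_def by (metis UN_iff UNIV_I)
  have charts: "is_chart C" "is_chart D" "is_chart E" "C2_compatible C E" "C2_compatible E D"
    using assms E by (auto simp: foliated_atlas_def foliated_charts_def)
  obtain N1 where N1: "open N1" "p \<in> N1" "N1 \<subseteq> chart_dom C \<inter> chart_dom E"
    "\<And>q q'. q \<in> N1 \<Longrightarrow> q' \<in> N1 \<Longrightarrow> trans_proj C q = trans_proj C q' \<Longrightarrow>
       trans_proj E q = trans_proj E q'"
    using C2_compatible_locally_constant[OF charts(1,3,4)] assms E by metis
  obtain N2 where N2: "open N2" "p \<in> N2" "N2 \<subseteq> chart_dom E \<inter> chart_dom D"
    "\<And>q q'. q \<in> N2 \<Longrightarrow> q' \<in> N2 \<Longrightarrow> trans_proj E q = trans_proj E q' \<Longrightarrow>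
       trans_proj D q = trans_proj D q'"
    using C2_compatible_locally_constant[OF charts(3,2,5)] assms E by metis
  show thesis
    by (rule that[of "N1 \<inter> N2"]) (use N1 N2 in \<open>blast+\<close>)
qed

lemma openin_leaf_topology_plaque:
  "C \<in> foliated_charts \<A> \<Longrightarrow> P \<in> plaques C \<Longrightarrow> openin (leaf_topology \<A>) P"
  unfolding leaf_topology_def by (rule topology_generated_by_Basis) blast

text \<open>The plaque is the image of the connected ball under a slice \<open>j\<close> of the
  inverse chart. This map is continuous even into the leaf topology, since near each of its points a
  plaque of \<open>C\<close> stays in one plaque of any chart \<open>D\<close> around that
  point.\<close>

lemma connectedin_leaf_topology_plaque:
  assumes "foliated_atlas \<A>" "C \<in> foliated_charts \<A>" "P \<in> plaques C"
  shows "connectedin (leaf_topology \<A>) P"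
proof -
  have C: "is_chart C" using assms(2) by (simp add: foliated_charts_def)
  obtain z where z: "z \<in> topspace (chart_trans C)" and P: "P = {p \<in> chart_dom C. trans_proj C p = z}"
    using assms(3) by (auto simp: plaques_def)
  define B where "B = chart_ball C"
  define j where "j x = chart_inv C (x, z)" for x
  have j: "j x \<in> chart_dom C" "chart_map C (j x) = (x, z)" "trans_proj C (j x) = z"
    if "x \<in> B" for x
    using chart_map_chart_inv[OF C _ z] that by (auto simp: j_def B_def trans_proj_def)
  have jB: "j ` B = P"
  proof (rule equalityI; rule subsetI)
    fix p assume "p \<in> P"
    then have p: "p \<in> chart_dom C" "snd (chart_map C p) = z"
      by (auto simp: P trans_proj_def)
    then have "fst (chart_map C p) \<in> B"
      unfolding B_def by (metis C chart_map_image imageI mem_Times_iff)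
    moreover have "j (fst (chart_map C p)) = p"
      unfolding j_def p(2)[symmetric] using C p(1) by simp
    ultimately show "p \<in> j ` B" by force
  qed (auto simp: P j)
  have cont: "continuous_map (top_of_set B) (top_of_set (chart_dom C)) j"
  proof -
    have hom: "homeomorphic_map (top_of_set (chart_dom C))
        (prod_topology (top_of_set B) (chart_trans C)) (chart_map C)"
      using C by (simp add: is_chart_def B_def)
    then obtain g where g: "homeomorphic_maps (top_of_set (chart_dom C))
        (prod_topology (top_of_set B) (chart_trans C)) (chart_map C) g"
      using homeomorphic_map_maps by blast
    have "continuous_map (top_of_set B) (prod_topology (top_of_set B) (chart_trans C)) (\<lambda>x. (x, z))"
      using z by (simp add: continuous_map_paired)
    then have "continuous_map (top_of_set B) (top_of_set (chart_dom C)) (g \<circ> (\<lambda>x. (x, z)))"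
      using g continuous_map_compose unfolding homeomorphic_maps_def by blast
    then show ?thesis
    proof (rule continuous_map_eq)
      fix x assume "x \<in> topspace (top_of_set B)"
      then have x: "x \<in> B" by simp
      then show "(g \<circ> (\<lambda>x. (x, z))) x = j x"
        using g j[OF x] unfolding homeomorphic_maps_def by (metis comp_apply topspace_euclidean_subtopology)
    qed
  qed
  have "continuous_map (top_of_set B) (leaf_topology \<A>) j"
    unfolding leaf_topology_def
  proof (rule continuous_on_generated_topo)
    fix Q assume "Q \<in> (\<Union>D\<in>foliated_charts \<A>. plaques D)"
    then obtain D w where D: "D \<in> foliated_charts \<A>"
      and Q: "Q = {p \<in> chart_dom D. trans_proj D p = w}"
      by (auto simp: plaques_def)
    show "openin (top_of_set B) (j -` Q \<inter> topspace (top_of_set B))"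
    proof (subst openin_subopen, safe)
      fix x assume x: "j x \<in> Q" "x \<in> topspace (top_of_set B)"
      then have "x \<in> B" by simp
      obtain N where N: "open N" "j x \<in> N" "N \<subseteq> chart_dom C \<inter> chart_dom D"
        "\<And>q. q \<in> N \<Longrightarrow> trans_proj C q = trans_proj C (j x) \<Longrightarrow> trans_proj D q = trans_proj D (j x)"
        using foliated_charts_locally_constant[OF assms(1,2) D] j(1)[OF \<open>x \<in> B\<close>] x(1) Q by blast
      have "openin (top_of_set (chart_dom C)) N"
        using N(1,3) by (auto simp: openin_open)
      from openin_continuous_map_preimage[OF cont this]
      have "openin (top_of_set B) {y \<in> B. j y \<in> N}" by simp
      moreover have "{y \<in> B. j y \<in> N} \<subseteq> j -` Q \<inter> topspace (top_of_set B)"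
        using N(3,4) j(3) \<open>x \<in> B\<close> x(1) Q by auto
      ultimately show "\<exists>T. openin (top_of_set B) T \<and> x \<in> T \<and> T \<subseteq> j -` Q \<inter> topspace (top_of_set B)"
        using \<open>x \<in> B\<close> N(2) by blast
    qed
  next
    show "j ` topspace (top_of_set B) \<subseteq> \<Union> (\<Union>C\<in>foliated_charts \<A>. plaques C)"
      using jB assms(2,3) by auto
  qed
  moreover have "connectedin (top_of_set B) B"
    using C by (auto simp: connectedin_subtopology B_def is_chart_def)
  ultimately show ?thesis
    using connectedin_continuous_map_image jB by blast
qed

section \<open>The plaque relation, and tools for counting and separating\<close>

text \<open>One step of a plaque chain; its powers turn out to describe the balls of the plaque
  distance, see \<open>plaque_dist_le_iff\<close>.\<close>

definition plaque_rel :: "('a, 'e, 'z) chart set \<Rightarrow> ('a \<times> 'a) set" where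
  "plaque_rel \<U> = {(p, q). \<exists>C\<in>\<U>. p \<in> chart_dom C \<and> q \<in> chart_dom C \<and> trans_proj C p = trans_proj C q}"

lemma sym_plaque_rel: "sym (plaque_rel \<U>)"
  unfolding plaque_rel_def sym_def by fastforce

lemma sym_relpow:
  assumes "sym R"
  shows "sym (R ^^ k)"
proof (induction k)
  case (Suc k)
  then show ?case
    using assms by (simp add: sym_conv_converse_eq converse_relcomp relpow_commute)
qed (simp add: sym_Id)

lemma connectedin_subset_open_cover:
  assumes "connectedin T S" "openin T U" "openin T V" "S \<subseteq> U \<union> V" "U \<inter> V \<inter> S = {}"
  shows "U \<inter> S = {} \<or> V \<inter> S = {}"
  using assms unfolding connectedin by metis

text \<open>Compares counting with and without multiplicity, for plaques that belong to several
  charts; the second bound holds because each \<open>F i\<close> is contained in the union.\<close>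

lemma sum_card_fibres:
  assumes "finite I" "\<And>i. i \<in> I \<Longrightarrow> finite (F i)"
  shows "card (\<Union>i\<in>I. F i) \<le> (\<Sum>i\<in>I. card (F i))"
    "(\<Sum>i\<in>I. card (F i)) \<le> card I * card (\<Union>i\<in>I. F i)"
proof -
  show "card (\<Union>i\<in>I. F i) \<le> (\<Sum>i\<in>I. card (F i))"
    by (rule card_UN_le[OF assms(1)])
  have "card (F i) \<le> card (\<Union>i\<in>I. F i)" if "i \<in> I" for i
    by (rule card_mono) (use assms that in auto)
  then show "(\<Sum>i\<in>I. card (F i)) \<le> card I * card (\<Union>i\<in>I. F i)"
    by (metis sum_bounded_above of_nat_id)
qed

lemma Hausdorff_space_separate_finite:
  assumes "Hausdorff_space T" "finite A" "A \<subseteq> topspace T"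
  obtains N where "\<And>a. a \<in> A \<Longrightarrow> openin T (N a)" "\<And>a. a \<in> A \<Longrightarrow> a \<in> N a"
    "\<And>a b. a \<in> A \<Longrightarrow> b \<in> A \<Longrightarrow> a \<noteq> b \<Longrightarrow> disjnt (N a) (N b)"
proof -
  have "\<forall>a\<in>A. \<forall>b\<in>A. \<exists>U V. a \<noteq> b \<longrightarrow> openin T U \<and> openin T V \<and> a \<in> U \<and> b \<in> V \<and> disjnt U V"
  proof (intro ballI)
    fix a b assume "a \<in> A" "b \<in> A"
    then show "\<exists>U V. a \<noteq> b \<longrightarrow> openin T U \<and> openin T V \<and> a \<in> U \<and> b \<in> V \<and> disjnt U V"
      using assms(1,3) unfolding Hausdorff_space_def by (cases "a = b") (simp, meson subsetD)
  qed
  then obtain U V where UV: "\<And>a b. a \<in> A \<Longrightarrow> b \<in> A \<Longrightarrow> a \<noteq> b \<Longrightarrow>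
      openin T (U a b) \<and> openin T (V a b) \<and> a \<in> U a b \<and> b \<in> V a b \<and> disjnt (U a b) (V a b)"
    by metis
  \<comment> \<open>The factors put \<open>N a\<close> inside \<open>U a b\<close> and
    \<open>N b\<close> inside \<open>V a b\<close>, which are disjoint; \<open>topspace T\<close>
    takes care of a single point.\<close>
  define N where "N a = topspace T \<inter> \<Inter>((\<lambda>b. U a b \<inter> V b a) ` (A - {a}))" for a
  show thesis
  proof (rule that[of N])
    show "openin T (N a)" if "a \<in> A" for a
    proof (cases "A - {a} = {}")
      case True
      then have "N a = topspace T" unfolding N_def by (simp only: image_empty Inter_empty Int_UNIV_right)
      then show ?thesis by simp
    next
      case False
      have "openin T (\<Inter>((\<lambda>b. U a b \<inter> V b a) ` (A - {a})))"
        by (rule openin_Inter) (use False assms(2) UV that in auto)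
      then show ?thesis unfolding N_def by blast
    qed
    show "a \<in> N a" if "a \<in> A" for a
      using UV that assms(3) by (auto simp: N_def)
    show "disjnt (N a) (N b)" if "a \<in> A" "b \<in> A" "a \<noteq> b" for a b
      using UV[of a b] that unfolding N_def disjnt_def by blast
  qed
qed

section \<open>Regular atlases on a compact space, and traces of balls\<close>

locale regular_foliated_space =
  fixes \<A> \<U> :: "('a::topological_space, real^'n, 'z) chart set"
  assumes compact_UNIV: "compact (UNIV :: 'a set)"
    and foliated: "foliated_atlas \<A>"
    and regular: "regular_atlas \<A> \<U>"
begin

abbreviation R :: "('a \<times> 'a) set" where
  "R \<equiv> plaque_rel \<U>"

text \<open>The plaques of \<open>C\<close> met by the ball of radius \<open>k\<close> around \<open>x\<close>, given by their transversal coordinates.\<close>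

definition traces :: "('a, real^'n, 'z) chart \<Rightarrow> nat \<Rightarrow> 'a \<Rightarrow> 'z set" where
  "traces C k x = trans_proj C ` ((R ^^ k) `` {x} \<inter> chart_dom C)"

text \<open>Local finiteness does not see charts with empty domain, of which a regular atlas may
  contain infinitely many; this set is finite.\<close>

definition inhabited :: "('a, real^'n, 'z) chart set" where
  "inhabited = {C \<in> \<U>. chart_dom C \<noteq> {}}"

text \<open>A plaque common to several charts is counted for each of them; in exchange every summand
  is lower semicontinuous on its own.\<close>

definition trace_count :: "nat \<Rightarrow> 'a \<Rightarrow> nat" where
  "trace_count k x = (\<Sum>C\<in>inhabited. card (traces C k x))"

lemma foliated_chart: "C \<in> \<U> \<Longrightarrow> C \<in> foliated_charts \<A>"
  using regular by (auto simp: regular_atlas_def)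

lemma is_chart: "C \<in> \<U> \<Longrightarrow> is_chart C"
  using foliated_chart by (auto simp: foliated_charts_def)

lemma covered:
  obtains C where "C \<in> \<U>" "p \<in> chart_dom C"
proof -
  have "(\<Union>C\<in>\<U>. chart_dom C) = UNIV"
    using regular by (simp add: regular_atlas_def)
  then show thesis using that by blast
qed

text \<open>The plaque of \<open>C\<close> through both points meets the plaques of \<open>D\<close>
  through \<open>p\<close> and through \<open>q\<close>; regularity allows only one such plaque of
  \<open>D\<close>.\<close>

lemma trans_proj_determined:
  assumes "C \<in> \<U>" "D \<in> \<U>" "p \<in> chart_dom C \<inter> chart_dom D" "q \<in> chart_dom C \<inter> chart_dom D"
    and "trans_proj C p = trans_proj C q"
  shows "trans_proj D p = trans_proj D q"
proof -
  let ?P = "{x \<in> chart_dom C. trans_proj C x = trans_proj C p}"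
  let ?Q = "\<lambda>y. {x \<in> chart_dom D. trans_proj D x = trans_proj D y}"
  have reg: "P \<in> plaques C \<Longrightarrow> Q \<in> plaques D \<Longrightarrow> Q' \<in> plaques D \<Longrightarrow>
      closure P \<inter> closure Q \<noteq> {} \<Longrightarrow> closure P \<inter> closure Q' \<noteq> {} \<Longrightarrow> Q = Q'" for P Q Q'
    using regular assms(1,2) unfolding regular_atlas_def by (elim conjE) simp
  have "?P \<in> plaques C" "?Q p \<in> plaques D" "?Q q \<in> plaques D"
    using assms is_chart by (auto intro!: plaque_through)
  moreover have "p \<in> closure ?P \<inter> closure (?Q p)" "q \<in> closure ?P \<inter> closure (?Q q)"
    using assms by (auto intro!: subsetD[OF closure_subset])
  ultimately have "?Q p = ?Q q"
    using reg[of ?P "?Q p" "?Q q"] by blast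
  then show ?thesis using assms(3) by blast
qed

lemma finite_inhabited: "finite inhabited"
proof -
  have "\<forall>p. \<exists>N. open N \<and> p \<in> N \<and> finite {C\<in>\<U>. chart_dom C \<inter> N \<noteq> {}}"
    using regular by (simp add: regular_atlas_def)
  from choice[OF this] obtain N where N: "\<And>p. open (N p)" "\<And>p. p \<in> N p"
      "\<And>p. finite {C\<in>\<U>. chart_dom C \<inter> N p \<noteq> {}}"
    by blast
  obtain F where F: "finite F" "UNIV \<subseteq> (\<Union>p\<in>F. N p)"
    by (rule compactE_image[OF compact_UNIV, of UNIV N]) (use N(1,2) in auto)
  have "inhabited \<subseteq> (\<Union>p\<in>F. {C\<in>\<U>. chart_dom C \<inter> N p \<noteq> {}})"
    using F(2) by (fastforce simp: inhabited_def)
  then show ?thesis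
    using F(1) N(3) by (meson finite_UN_I finite_subset)
qed

section \<open>Openness of the plaque relation and semicontinuity of the trace counts\<close>

lemma open_plaque_rel_image:
  assumes "open W"
  shows "open (R `` W)"
proof -
  have "R `` W = (\<Union>C\<in>\<U>. {p \<in> chart_dom C. \<exists>q \<in> W \<inter> chart_dom C. trans_proj C p = trans_proj C q})"
    unfolding plaque_rel_def by (rule set_eqI) (simp add: Image_iff Bex_def, metis)
  then show ?thesis
    using open_chart_saturation[OF is_chart assms] by (simp add: open_UN)
qed

lemma open_relpow_image: "open W \<Longrightarrow> open ((R ^^ k) `` W)"
  by (induction k) (simp_all add: relcomp_Image open_plaque_rel_image)

lemma relpow_sym: "(x, y) \<in> R ^^ k \<Longrightarrow> (y, x) \<in> R ^^ k"
  using sym_relpow[OF sym_plaque_rel] by (rule symD)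

lemma plaque_rel_refl: "(x, x) \<in> R"
  using covered[of x] by (auto simp: plaque_rel_def)

lemma relpow_mono_index:
  assumes "(x, y) \<in> R ^^ k" "k \<le> l"
  shows "(x, y) \<in> R ^^ l"
  using assms(2,1)
proof (induction rule: dec_induct)
  case (step l)
  then show ?case using plaque_rel_refl by auto
qed

text \<open>A plaque of \<open>D\<close> meets at most one plaque of \<open>C\<close>, so each trace
  in \<open>D\<close> after \<open>k\<close> steps yields at most one trace in \<open>C\<close> at
  the next step, and finitely many \<open>D\<close> occur.\<close>

lemma finite_traces: "C \<in> \<U> \<Longrightarrow> finite (traces C k x)"
proof (induction k arbitrary: C)
  case 0
  have "traces C 0 x \<subseteq> {trans_proj C x}"
    by (auto simp: traces_def)
  then show ?case using finite_subset by blast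
next
  case (Suc k)
  \<comment> \<open>The coordinate in \<open>C\<close> of the only plaque of \<open>C\<close>
    meeting the plaque of \<open>D\<close> over \<open>z\<close>; the value is arbitrary if there is
    none.\<close>
  define f where "f D z = (SOME w. \<exists>q \<in> chart_dom D \<inter> chart_dom C. trans_proj D q = z \<and> trans_proj C q = w)"
    for D :: "('a, real^'n, 'z) chart" and z
  have "traces C (Suc k) x \<subseteq> (\<Union>D\<in>inhabited. f D ` traces D k x)"
  proof
    fix w assume "w \<in> traces C (Suc k) x"
    then obtain q where q: "(x, q) \<in> R ^^ Suc k" "q \<in> chart_dom C" "w = trans_proj C q"
      by (auto simp: traces_def)
    then obtain p where p: "(x, p) \<in> R ^^ k" "(p, q) \<in> R"
      by auto
    then obtain D where D: "D \<in> \<U>" "p \<in> chart_dom D" "q \<in> chart_dom D"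
        "trans_proj D p = trans_proj D q"
      by (auto simp: plaque_rel_def)
    have "\<exists>q' \<in> chart_dom D \<inter> chart_dom C. trans_proj D q' = trans_proj D p \<and> trans_proj C q' = f D (trans_proj D p)"
      unfolding f_def by (rule someI_ex) (use D q in auto)
    then have "f D (trans_proj D p) = trans_proj C q"
      using trans_proj_determined[OF D(1) Suc.prems] D q by (metis IntI)
    moreover have "trans_proj D p \<in> traces D k x"
      using p(1) D(2) by (auto simp: traces_def)
    moreover have "D \<in> inhabited"
      using D by (auto simp: inhabited_def)
    ultimately show "w \<in> (\<Union>D\<in>inhabited. f D ` traces D k x)"
      using q(3) by (intro UN_I[of D] image_eqI[of _ _ "trans_proj D p"]) simp_all
  qed
  moreover have "finite (\<Union>D\<in>inhabited. f D ` traces D k x)"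
    by (intro finite_UN_I finite_inhabited finite_imageI Suc.IH) (simp add: inhabited_def)
  ultimately show ?case using finite_subset by blast
qed

text \<open>Any \<open>m\<close> traces at \<open>x\<close> have disjoint neighbourhoods
  \<open>N z\<close>. From every point near \<open>x\<close>, a plaque over each \<open>N z\<close>
  is still reached in \<open>k\<close> steps, and these plaques are distinct.\<close>

lemma open_card_traces_ge:
  assumes "C \<in> \<U>"
  shows "open {x. m \<le> card (traces C k x)}"
proof (subst open_subopen, safe)
  fix x assume "m \<le> card (traces C k x)"
  then obtain A where A: "A \<subseteq> traces C k x" "card A = m" "finite A"
    by (rule obtain_subset_with_card_n)
  have C: "is_chart C" by (rule is_chart[OF assms])
  have "Hausdorff_space (chart_trans C)"
    using C completely_metrizable_imp_metrizable_space metrizable_imp_Hausdorff_space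
    unfolding is_chart_def polish_topology_def by blast
  moreover have "A \<subseteq> topspace (chart_trans C)"
    using A(1) trans_proj_in_topspace[OF C] by (auto simp: traces_def)
  ultimately obtain N where N: "\<And>z. z \<in> A \<Longrightarrow> openin (chart_trans C) (N z)" "\<And>z. z \<in> A \<Longrightarrow> z \<in> N z"
      "\<And>z w. z \<in> A \<Longrightarrow> w \<in> A \<Longrightarrow> z \<noteq> w \<Longrightarrow> disjnt (N z) (N w)"
    using Hausdorff_space_separate_finite[of "chart_trans C" A] A(3) by metis
  define W where "W z = {p \<in> chart_dom C. trans_proj C p \<in> N z}" for z
  \<comment> \<open>By symmetry of \<open>R\<close>, the image of \<open>W z\<close> under
    \<open>R ^^ k\<close> consists of the points from which \<open>W z\<close> is reached in
    \<open>k\<close> steps.\<close>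
  let ?O = "\<Inter>z\<in>A. (R ^^ k) `` W z"
  have "open ?O"
    using A(3) N(1) by (auto intro!: open_relpow_image open_trans_proj_vimage[OF C] simp: W_def)
  moreover have "x \<in> ?O"
  proof
    fix z assume "z \<in> A"
    then obtain q where "(x, q) \<in> R ^^ k" "q \<in> chart_dom C" "trans_proj C q = z"
      using A(1) by (auto simp: traces_def)
    then show "x \<in> (R ^^ k) `` W z"
      using relpow_sym[of x q k] N(2)[OF \<open>z \<in> A\<close>] unfolding W_def by blast
  qed
  moreover have "m \<le> card (traces C k y)" if "y \<in> ?O" for y
  proof -
    have "\<exists>w. w \<in> N z \<inter> traces C k y" if "z \<in> A" for z
    proof -
      obtain q where "(q, y) \<in> R ^^ k" "q \<in> W z"
        using \<open>z \<in> A\<close> \<open>y \<in> ?O\<close> by (elim INT_E ImageE) auto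
      then have "trans_proj C q \<in> N z \<inter> traces C k y"
        using relpow_sym[of q y k] by (simp add: W_def traces_def)
      then show ?thesis ..
    qed
    then obtain g where g: "\<And>z. z \<in> A \<Longrightarrow> g z \<in> N z \<inter> traces C k y"
      by metis
    have "inj_on g A"
    proof (rule inj_onI)
      fix z w assume "z \<in> A" "w \<in> A" "g z = g w"
      then show "z = w" using g[of z] g[of w] N(3)[of z w] by (auto simp: disjnt_iff)
    qed
    moreover have "g ` A \<subseteq> traces C k y" using g by blast
    ultimately show ?thesis
      using card_inj_on_le[OF _ _ finite_traces[OF assms]] A(2) by blast
  qed
  ultimately show "\<exists>T. open T \<and> x \<in> T \<and> T \<subseteq> {x. m \<le> card (traces C k x)}"
    by blast
qed

lemma borel_measurable_trace_count [measurable]: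
  "(\<lambda>x. real (trace_count k x)) \<in> borel_measurable borel"
proof -
  have "(\<lambda>x. real (card (traces C k x))) \<in> borel_measurable borel" if "C \<in> inhabited" for C
  proof -
    \<comment> \<open>For \<open>a \<le> 0\<close> the truncation \<open>nat\<close> gives the
      threshold 0, and both sets are the whole space.\<close>
    have "{x. a \<le> real (card (traces C k x))} = {x. nat \<lceil>a\<rceil> \<le> card (traces C k x)}" for a :: real
      by (auto simp: nat_le_iff ceiling_le_iff)
    moreover have "C \<in> \<U>" using that by (simp add: inhabited_def)
    ultimately have "{x. a \<le> real (card (traces C k x))} \<in> sets borel" for a :: real
      by (simp only: borel_open open_card_traces_ge)
    then show ?thesis
      unfolding borel_measurable_iff_ge by simp
  qed
  then show ?thesis
    unfolding trace_count_def of_nat_sum by (rule borel_measurable_sum)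
qed

section \<open>Plaque chains, leaves and the plaque distance\<close>

text \<open>Consecutive plaques of a chain share a point, so their union is connected. Plaques may
  repeat, hence only \<open>card \<P> \<le> k\<close>; even for \<open>x = y\<close> one plaque is
  needed, hence \<open>k > 0\<close>.\<close>

lemma relpow_imp_connected_plaques:
  assumes "(x, y) \<in> R ^^ k" "k > 0"
  obtains \<P> where "\<P> \<subseteq> (\<Union>C\<in>\<U>. plaques C)" "finite \<P>" "card \<P> \<le> k"
    "connectedin (leaf_topology \<A>) (\<Union>\<P>)" "x \<in> \<Union>\<P>" "y \<in> \<Union>\<P>"
proof -
  have "\<exists>\<P>. \<P> \<subseteq> (\<Union>C\<in>\<U>. plaques C) \<and> finite \<P> \<and> card \<P> \<le> Suc j \<and>
      connectedin (leaf_topology \<A>) (\<Union>\<P>) \<and> x \<in> \<Union>\<P> \<and> y \<in> \<Union>\<P>" if "(x, y) \<in> R ^^ Suc j" for j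
    using that
  proof (induction j arbitrary: y)
    case 0
    then obtain C where C: "C \<in> \<U>" "x \<in> chart_dom C" "y \<in> chart_dom C" "trans_proj C x = trans_proj C y"
      by (auto simp: plaque_rel_def)
    let ?P = "{q \<in> chart_dom C. trans_proj C q = trans_proj C x}"
    have P: "?P \<in> plaques C" using C is_chart by (auto intro: plaque_through)
    then have "connectedin (leaf_topology \<A>) ?P"
      using connectedin_leaf_topology_plaque foliated foliated_chart C(1) by blast
    then show ?case
      using P C by (intro exI[of _ "{?P}"]) auto
  next
    case (Suc j)
    then obtain p where p: "(x, p) \<in> R ^^ Suc j" "(p, y) \<in> R"
      by auto
    then obtain C where C: "C \<in> \<U>" "p \<in> chart_dom C" "y \<in> chart_dom C" "trans_proj C p = trans_proj C y"
      by (auto simp: plaque_rel_def)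
    obtain \<P> where \<P>: "\<P> \<subseteq> (\<Union>C\<in>\<U>. plaques C)" "finite \<P>" "card \<P> \<le> Suc j"
      "connectedin (leaf_topology \<A>) (\<Union>\<P>)" "x \<in> \<Union>\<P>" "p \<in> \<Union>\<P>"
      using Suc.IH[OF p(1)] by blast
    let ?P = "{q \<in> chart_dom C. trans_proj C q = trans_proj C p}"
    have P: "?P \<in> plaques C" using C is_chart by (auto intro: plaque_through)
    then have "connectedin (leaf_topology \<A>) ?P"
      using connectedin_leaf_topology_plaque foliated foliated_chart C(1) by blast
    then have "connectedin (leaf_topology \<A>) (?P \<union> \<Union>\<P>)"
      by (rule connectedin_Un) (use \<P> C in auto)
    moreover have "card (insert ?P \<P>) \<le> Suc (Suc j)"
      using \<P>(2,3) by (simp add: card_insert_if)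
    ultimately show ?case
      using P C \<P> by (intro exI[of _ "insert ?P \<P>"]) auto
  qed
  then show thesis
    using assms that by (metis gr0_implies_Suc)
qed

text \<open>Starting from a plaque containing \<open>x\<close>, plaques are added one at a time. As
  plaques are open in the leaf topology, connectedness forces a proper subfamily to meet one of the
  remaining plaques, whose points are then one step further away.\<close>

lemma connected_plaques_imp_relpow:
  assumes "\<P> \<subseteq> (\<Union>C\<in>\<U>. plaques C)" "finite \<P>"
    and conn: "connectedin (leaf_topology \<A>) (\<Union>\<P>)" and "x \<in> \<Union>\<P>" "y \<in> \<Union>\<P>"
  shows "(x, y) \<in> R ^^ card \<P>"
proof -
  have opn: "openin (leaf_topology \<A>) (\<Union>\<Q>)" if "\<Q> \<subseteq> \<P>" for \<Q>
    using that assms(1) foliated_chart openin_leaf_topology_plaque by (intro openin_Union) blast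
  have ne: "P \<noteq> {}" if "P \<in> \<P>" for P
    using that assms(1) plaques_nonempty is_chart by blast
  have rel: "(p, q) \<in> R" if "P \<in> \<P>" "p \<in> P" "q \<in> P" for P p q
    using that assms(1) by (fastforce simp: plaque_rel_def plaques_def)
  have "\<exists>\<Q> \<subseteq> \<P>. card \<Q> = Suc j \<and> x \<in> \<Union>\<Q> \<and> (\<forall>q\<in>\<Union>\<Q>. (x, q) \<in> R ^^ Suc j)"
    if "Suc j \<le> card \<P>" for j
    using that
  proof (induction j)
    case 0
    obtain P where "P \<in> \<P>" "x \<in> P" using assms(4) by blast
    then show ?case using rel by (intro exI[of _ "{P}"]) auto
  next
    case (Suc j)
    then obtain \<Q> where \<Q>: "\<Q> \<subseteq> \<P>" "card \<Q> = Suc j" "x \<in> \<Union>\<Q>"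
        "\<forall>q\<in>\<Union>\<Q>. (x, q) \<in> R ^^ Suc j"
      by auto
    have "\<Q> \<noteq> \<P>" using \<Q>(2) Suc.prems by auto
    then obtain P0 where "P0 \<in> \<P> - \<Q>" using \<Q>(1) by blast
    \<comment> \<open>Connectedness says something only if the leftover union is nonempty, hence the
      nonemptiness of plaques.\<close>
    then have "\<Union>(\<P> - \<Q>) \<noteq> {}" using ne by blast
    moreover have "\<Union>\<P> \<subseteq> \<Union>\<Q> \<union> \<Union>(\<P> - \<Q>)" by blast
    moreover have "\<Union>(\<P> - \<Q>) \<subseteq> \<Union>\<P>" by blast
    ultimately have "\<Union>\<Q> \<inter> \<Union>(\<P> - \<Q>) \<noteq> {}"
      using connectedin_subset_open_cover[OF conn opn[OF \<Q>(1)] opn[of "\<P> - \<Q>"]] \<Q>(1,3) assms(4)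
      by blast
    then obtain P p where P: "P \<in> \<P> - \<Q>" "p \<in> P" "p \<in> \<Union>\<Q>" by blast
    have "(x, q) \<in> R ^^ Suc (Suc j)" if "q \<in> \<Union>(insert P \<Q>)" for q
    proof (cases "q \<in> P")
      case True
      have "(x, p) \<in> R ^^ Suc j" using \<Q>(4) P(3) by (rule bspec)
      moreover have "(p, q) \<in> R" using rel P(1,2) True by (meson DiffD1)
      ultimately show ?thesis by (rule relpow_Suc_I)
    next
      case False
      then have "q \<in> \<Union>\<Q>" using that by blast
      with \<Q>(4) have "(x, q) \<in> R ^^ Suc j" by (rule bspec)
      then show ?thesis by (rule relpow_mono_index) simp
    qed
    moreover have "card (insert P \<Q>) = Suc (Suc j)"
      using \<Q>(2) P(1) finite_subset[OF \<Q>(1) assms(2)] by simp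
    ultimately show ?case
      using P(1) \<Q>(1,3) by (intro exI[of _ "insert P \<Q>"]) auto
  qed
  moreover have "card \<P> \<noteq> 0"
    using assms(2,4) by auto
  then obtain k where k: "card \<P> = Suc k"
    using not0_implies_Suc by blast
  ultimately obtain \<Q> where \<Q>: "\<Q> \<subseteq> \<P>" "card \<Q> = card \<P>" "\<forall>q\<in>\<Union>\<Q>. (x, q) \<in> R ^^ card \<P>"
    by (metis order_refl)
  have "\<Q> = \<P>"
    by (rule card_subset_eq[OF assms(2) \<Q>(1,2)])
  then show ?thesis
    using \<Q>(3) assms(5) by (metis bspec)
qed

lemma topspace_leaf_topology: "topspace (leaf_topology \<A>) = UNIV"
proof -
  have "x \<in> topspace (leaf_topology \<A>)" for x
  proof -
    obtain C where C: "C \<in> \<U>" "x \<in> chart_dom C" by (rule covered)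
    then show ?thesis
      using plaque_through[OF is_chart C(2)] openin_subset[OF openin_leaf_topology_plaque] foliated_chart
      by blast
  qed
  then show ?thesis by blast
qed

text \<open>A chain spans a connected union of plaques. Conversely, the set \<open>A\<close> of
  points reached from \<open>x\<close> and its complement are both unions of plaques, hence open, so
  a connected set cannot meet both.\<close>

lemma in_leaf_iff: "y \<in> leaf \<A> x \<longleftrightarrow> (\<exists>k. (x, y) \<in> R ^^ k)"
proof
  assume "\<exists>k. (x, y) \<in> R ^^ k"
  then obtain k where "(x, y) \<in> R ^^ Suc k"
    using relpow_mono_index le_SucI by (meson order_refl)
  then show "y \<in> leaf \<A> x"
    using relpow_imp_connected_plaques[of x y "Suc k"]
    unfolding leaf_def by (metis connected_component_of_def mem_Collect_eq zero_less_Suc)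
next
  assume "y \<in> leaf \<A> x"
  then obtain S where S: "connectedin (leaf_topology \<A>) S" "x \<in> S" "y \<in> S"
    by (auto simp: leaf_def connected_component_of_def)
  define A where "A = {q. \<exists>k. (x, q) \<in> R ^^ k}"
  have A_step: "q \<in> A" if "p \<in> A" "(p, q) \<in> R" for p q
    using that relpow_Suc_I[of x p _ R q] unfolding A_def by blast
  have step: "p \<in> A \<longleftrightarrow> q \<in> A" if "(p, q) \<in> R" for p q
    using A_step[of p q] A_step[of q p] that symD[OF sym_plaque_rel that] by blast
  have "openin (leaf_topology \<A>) B" if B: "B = A \<or> B = - A" for B
  proof (subst openin_subopen, safe)
    fix p assume p: "p \<in> B"
    obtain C where C: "C \<in> \<U>" "p \<in> chart_dom C" by (rule covered)
    let ?P = "{q \<in> chart_dom C. trans_proj C q = trans_proj C p}"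
    have "openin (leaf_topology \<A>) ?P"
      using openin_leaf_topology_plaque[OF foliated_chart] plaque_through[OF is_chart] C by blast
    moreover have "?P \<subseteq> B"
    proof
      fix q assume "q \<in> ?P"
      then have "(p, q) \<in> R" using C by (auto simp: plaque_rel_def)
      from step[OF this] p B show "q \<in> B" by auto
    qed
    ultimately show "\<exists>T. openin (leaf_topology \<A>) T \<and> p \<in> T \<and> T \<subseteq> B"
      using C(2) by blast
  qed
  then have "openin (leaf_topology \<A>) A" "openin (leaf_topology \<A>) (- A)" by simp_all
  moreover have "x \<in> A" unfolding A_def by (auto intro: exI[of _ 0])
  ultimately have "y \<in> A"
    using connectedin_subset_open_cover[OF S(1), of A "- A"] S(2,3) by blast
  then show "\<exists>k. (x, y) \<in> R ^^ k" by (simp add: A_def)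
qed

text \<open>Chains of \<open>k\<close> steps give families of at most \<open>k\<close> plaques, and
  families of \<open>k\<close> plaques give chains of \<open>k\<close> steps. On a leaf some family
  exists, so the \<open>LEAST\<close> in the distance is attained.\<close>

lemma plaque_dist_le_iff:
  assumes "y \<in> leaf \<A> x"
  shows "plaque_dist \<A> \<U> x y \<le> k \<longleftrightarrow> (x, y) \<in> R ^^ k"
proof (cases "x = y")
  case True
  then show ?thesis
    using relpow_mono_index[of x x 0 k] by (simp add: plaque_dist_def)
next
  case False
  define Q where "Q k \<longleftrightarrow> (\<exists>\<P> \<subseteq> (\<Union>C\<in>\<U>. plaques C).
        finite \<P> \<and> card \<P> = k \<and> connectedin (leaf_topology \<A>) (\<Union>\<P>) \<and> x \<in> \<Union>\<P> \<and> y \<in> \<Union>\<P>)" for k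
  have dist: "plaque_dist \<A> \<U> x y = (LEAST k. Q k)"
    using False by (simp add: plaque_dist_def Q_def)
  have ex: "\<exists>j\<le>l. Q j" if "(x, y) \<in> R ^^ l" for l
  proof -
    have "l > 0" using that False by (cases l) auto
    from relpow_imp_connected_plaques[OF that this] show ?thesis
      unfolding Q_def by metis
  qed
  show ?thesis
  proof
    assume "(x, y) \<in> R ^^ k"
    from ex[OF this] show "plaque_dist \<A> \<U> x y \<le> k"
      unfolding dist using Least_le order_trans by blast
  next
    assume "plaque_dist \<A> \<U> x y \<le> k"
    moreover have "Q (plaque_dist \<A> \<U> x y)"
      unfolding dist using assms ex in_leaf_iff by (metis LeastI)
    then have "(x, y) \<in> R ^^ plaque_dist \<A> \<U> x y"
      unfolding Q_def using connected_plaques_imp_relpow by metis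
    ultimately show "(x, y) \<in> R ^^ k"
      using relpow_mono_index by blast
  qed
qed

section \<open>Plaque growth compared with the trace counts\<close>

text \<open>Distances are integers and the ball is defined by a strict inequality, so radius
  \<open>r\<close> amounts to at most \<open>\<lceil>r\<rceil> - 1\<close> steps.\<close>

lemma plaque_growth_eq:
  assumes "r > 0" "k = nat \<lceil>r\<rceil> - 1"
  shows "plaque_growth \<A> \<U> x r =
    real (card {P \<in> (\<Union>C\<in>\<U>. plaques C). P \<inter> (R ^^ k) `` {x} \<noteq> {}})"
proof -
  have "real d < r \<longleftrightarrow> d \<le> k" for d :: nat
    using assms by linarith
  then have "{y \<in> leaf \<A> x. real (plaque_dist \<A> \<U> x y) < r} = (R ^^ k) `` {x}"
    using plaque_dist_le_iff[of _ x k] in_leaf_iff[of _ x] by blast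
  then show ?thesis by (simp add: plaque_growth_def)
qed

lemma plaques_meeting:
  "{P \<in> (\<Union>C\<in>\<U>. plaques C). P \<inter> (R ^^ k) `` {x} \<noteq> {}} =
     (\<Union>C\<in>inhabited. (\<lambda>z. {p \<in> chart_dom C. trans_proj C p = z}) ` traces C k x)"
  (is "?L = ?R")
proof
  show "?L \<subseteq> ?R"
    by (fastforce simp: plaques_def inhabited_def traces_def)
  show "?R \<subseteq> ?L"
  proof
    fix P assume "P \<in> ?R"
    then obtain C q where C: "C \<in> \<U>" "q \<in> chart_dom C" "(x, q) \<in> R ^^ k"
      and P: "P = {p \<in> chart_dom C. trans_proj C p = trans_proj C q}"
      unfolding inhabited_def traces_def by blast
    have "P \<in> plaques C"
      unfolding P by (rule plaque_through[OF is_chart[OF C(1)] C(2)])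
    moreover have "q \<in> P" using C(2) by (simp add: P)
    ultimately show "P \<in> ?L" using C(1,3) by blast
  qed
qed

lemma finite_plaques_meeting: "finite {P \<in> (\<Union>C\<in>\<U>. plaques C). P \<inter> (R ^^ k) `` {x} \<noteq> {}}"
  unfolding plaques_meeting using finite_inhabited finite_traces by (auto simp: inhabited_def)

lemma card_plaques_meeting:
  "card {P \<in> (\<Union>C\<in>\<U>. plaques C). P \<inter> (R ^^ k) `` {x} \<noteq> {}} \<le> trace_count k x"
  "trace_count k x \<le> card inhabited * card {P \<in> (\<Union>C\<in>\<U>. plaques C). P \<inter> (R ^^ k) `` {x} \<noteq> {}}"
proof -
  let ?F = "\<lambda>C. (\<lambda>z. {p \<in> chart_dom C. trans_proj C p = z}) ` traces C k x"
  \<comment> \<open>Within one chart distinct traces have distinct nonempty fibres; multiplicities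
    arise only between charts.\<close>
  have "inj_on (\<lambda>z. {p \<in> chart_dom C. trans_proj C p = z}) (traces C k x)" for C
    by (rule inj_onI) (auto simp: traces_def)
  then have "trace_count k x = (\<Sum>C\<in>inhabited. card (?F C))"
    by (simp add: trace_count_def card_image)
  moreover have "finite (?F C)" if "C \<in> inhabited" for C
    using that finite_traces by (simp add: inhabited_def)
  ultimately show "card {P \<in> (\<Union>C\<in>\<U>. plaques C). P \<inter> (R ^^ k) `` {x} \<noteq> {}} \<le> trace_count k x"
    "trace_count k x \<le> card inhabited * card {P \<in> (\<Union>C\<in>\<U>. plaques C). P \<inter> (R ^^ k) `` {x} \<noteq> {}}"
    unfolding plaques_meeting using sum_card_fibres[OF finite_inhabited, of ?F] by simp_all
qed

lemma plaque_growth_bounds: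
  assumes "r > 0"
  shows "plaque_growth \<A> \<U> x r \<le> real (trace_count (nat \<lceil>r\<rceil> - 1) x)"
    "real (trace_count (nat \<lceil>r\<rceil> - 1) x) \<le> real (card inhabited) * plaque_growth \<A> \<U> x r"
  unfolding plaque_growth_eq[OF assms refl] of_nat_mult[symmetric] of_nat_le_iff
  by (rule card_plaques_meeting)+

text \<open>Since the ball is strict, the radius \<open>1 + real k\<close> corresponds to exactly
  \<open>k\<close> steps.\<close>

lemma plaque_growth_bounds_of_nat:
  "plaque_growth \<A> \<U> x (1 + real k) \<le> real (trace_count k x)"
  "real (trace_count k x) \<le> real (card inhabited) * plaque_growth \<A> \<U> x (1 + real k)"
proof -
  have "nat \<lceil>1 + real k\<rceil> - 1 = k" by linarith
  then show "plaque_growth \<A> \<U> x (1 + real k) \<le> real (trace_count k x)"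
    "real (trace_count k x) \<le> real (card inhabited) * plaque_growth \<A> \<U> x (1 + real k)"
    using plaque_growth_bounds[of "1 + real k" x] by simp_all
qed

lemma plaque_growth_nonneg: "plaque_growth \<A> \<U> x r \<ge> 0"
  by (simp add: plaque_growth_def)

lemma plaque_growth_mono:
  assumes "0 < r" "r \<le> s"
  shows "plaque_growth \<A> \<U> x r \<le> plaque_growth \<A> \<U> x s"
proof -
  have "nat \<lceil>r\<rceil> - 1 \<le> nat \<lceil>s\<rceil> - 1"
    using assms by (intro diff_le_mono nat_mono ceiling_mono)
  then have "(R ^^ (nat \<lceil>r\<rceil> - 1)) `` {x} \<subseteq> (R ^^ (nat \<lceil>s\<rceil> - 1)) `` {x}"
    using relpow_mono_index by blast
  then have "card {P \<in> (\<Union>C\<in>\<U>. plaques C). P \<inter> (R ^^ (nat \<lceil>r\<rceil> - 1)) `` {x} \<noteq> {}}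
      \<le> card {P \<in> (\<Union>C\<in>\<U>. plaques C). P \<inter> (R ^^ (nat \<lceil>s\<rceil> - 1)) `` {x} \<noteq> {}}"
    by (intro card_mono finite_plaques_meeting) blast
  then show ?thesis
    using assms by (simp add: plaque_growth_eq)
qed

section \<open>Domination as a measurable preorder\<close>

text \<open>Integer constants and radii leave only countable quantifiers, so measurability in the
  pair of points follows from that of the trace counts. Unlike in \<open>dominated\<close>, the
  constants may be zero.\<close>

definition trace_dominated :: "'a \<Rightarrow> 'a \<Rightarrow> bool" where
  "trace_dominated x y \<longleftrightarrow>
     (\<exists>a b c :: nat. \<forall>n\<ge>c. real (trace_count n x) \<le> real a * real (trace_count (b * n) y))"

lemma dominated_plaque_growth_iff:
  "dominated (plaque_growth \<A> \<U> x) (plaque_growth \<A> \<U> y) \<longleftrightarrow> trace_dominated x y"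
proof
  let ?N = "card inhabited"
  assume "dominated (plaque_growth \<A> \<U> x) (plaque_growth \<A> \<U> y)"
  then obtain a b c where abc: "a \<ge> 1" "b \<ge> 1" "c > 0"
    and dom: "\<And>r. r \<ge> c \<Longrightarrow> plaque_growth \<A> \<U> x r \<le> a * plaque_growth \<A> \<U> y (b * r)"
    unfolding dominated_def by metis
  define B where "B = nat \<lceil>b\<rceil>"
  \<comment> \<open>The factor \<open>?N\<close> pays for plaques counted in several charts;
    \<open>2 * B\<close> comes from \<open>b * (1 + n) \<le> 2 * B * n\<close> for
    \<open>n \<ge> 1\<close>.\<close>
  have "real (trace_count n x) \<le> real (?N * nat \<lceil>a\<rceil>) * real (trace_count (2 * B * n) y)"
    if n: "n \<ge> max 1 (nat \<lceil>c\<rceil>)" for n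
  proof -
    have n1: "real n \<ge> 1" "c \<le> 1 + real n"
      using n by linarith+
    have bB: "b \<le> real B" "a \<le> real (nat \<lceil>a\<rceil>)" unfolding B_def by linarith+
    have "b * (1 + real n) \<le> real B * (2 * real n)"
      using bB(1) abc(2) n1(1) by (intro mult_mono) auto
    then have le: "b * (1 + real n) \<le> 1 + real (2 * B * n)"
      by (simp add: mult_ac)
    have "real (trace_count n x) \<le> real ?N * plaque_growth \<A> \<U> x (1 + real n)"
      by (rule plaque_growth_bounds_of_nat)
    also have "\<dots> \<le> real ?N * (a * plaque_growth \<A> \<U> y (b * (1 + real n)))"
      using dom[OF n1(2)] by (intro mult_left_mono) auto
    also have "\<dots> \<le> real ?N * (a * plaque_growth \<A> \<U> y (1 + real (2 * B * n)))"
      using abc le by (intro mult_left_mono plaque_growth_mono) auto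
    also have "\<dots> \<le> real ?N * (a * real (trace_count (2 * B * n) y))"
      using abc by (intro mult_left_mono plaque_growth_bounds_of_nat) auto
    also have "\<dots> \<le> real ?N * (real (nat \<lceil>a\<rceil>) * real (trace_count (2 * B * n) y))"
      using bB(2) by (intro mult_left_mono mult_right_mono) auto
    finally show ?thesis by (simp add: mult_ac)
  qed
  then show "trace_dominated x y"
    unfolding trace_dominated_def by blast
next
  let ?N = "card inhabited"
  assume "trace_dominated x y"
  then obtain a b c :: nat
    where dom: "\<And>n. n \<ge> c \<Longrightarrow> real (trace_count n x) \<le> real a * real (trace_count (b * n) y)"
    unfolding trace_dominated_def by blast
  \<comment> \<open>Adding 1 to \<open>a * ?N\<close> and to \<open>b\<close> gives constants at
    least 1, as \<open>dominated\<close> requires. Moreover \<open>Suc b\<close> absorbs the shift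
    in \<open>1 + b * k \<le> (b + 1) * r\<close>, valid for \<open>k \<le> r\<close> and
    \<open>1 \<le> r\<close>, and \<open>Suc c\<close> ensures \<open>c \<le> k\<close>.\<close>
  have "plaque_growth \<A> \<U> x r \<le> (1 + real (a * ?N)) * plaque_growth \<A> \<U> y (real (Suc b) * r)"
    if r: "r \<ge> real (Suc c)" for r
  proof -
    define k where "k = nat \<lceil>r\<rceil> - 1"
    have k: "k \<ge> c" "real k \<le> r" "r > 0" "r \<ge> 1"
      using r unfolding k_def by linarith+
    have "real b * real k \<le> real b * r" using k(2) by (intro mult_left_mono) auto
    then have le: "1 + real (b * k) \<le> real (Suc b) * r"
      using k(4) by (simp add: distrib_right)
    have "plaque_growth \<A> \<U> x r \<le> real (trace_count k x)"
      using plaque_growth_bounds(1)[OF k(3)] by (simp add: k_def)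
    also have "\<dots> \<le> real a * real (trace_count (b * k) y)"
      by (rule dom[OF k(1)])
    also have "\<dots> \<le> real a * (real ?N * plaque_growth \<A> \<U> y (1 + real (b * k)))"
      by (intro mult_left_mono plaque_growth_bounds_of_nat) auto
    also have "\<dots> \<le> real a * (real ?N * plaque_growth \<A> \<U> y (real (Suc b) * r))"
      using le by (intro mult_left_mono plaque_growth_mono add_pos_nonneg) auto
    also have "\<dots> \<le> (1 + real (a * ?N)) * plaque_growth \<A> \<U> y (real (Suc b) * r)"
      using plaque_growth_nonneg[of y "real (Suc b) * r"] by (simp add: distrib_right mult_ac)
    finally show ?thesis .
  qed
  then show "dominated (plaque_growth \<A> \<U> x) (plaque_growth \<A> \<U> y)"
    unfolding dominated_def
    by (intro exI[of _ "1 + real (a * ?N)"] exI[of _ "real (Suc b)"] exI[of _ "real (Suc c)"]) auto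
qed

lemma trace_dominated_trans:
  assumes "trace_dominated x y" "trace_dominated y z"
  shows "trace_dominated x z"
proof -
  obtain a b c :: nat
    where 1: "\<And>n. n \<ge> c \<Longrightarrow> real (trace_count n x) \<le> real a * real (trace_count (b * n) y)"
    using assms(1) unfolding trace_dominated_def by blast
  obtain a' b' c' :: nat
    where 2: "\<And>n. n \<ge> c' \<Longrightarrow> real (trace_count n y) \<le> real a' * real (trace_count (b' * n) z)"
    using assms(2) unfolding trace_dominated_def by blast
  have mono: "trace_count m y \<le> trace_count n y" if "m \<le> n" for m n
    unfolding trace_count_def
  proof (rule sum_mono)
    fix C assume "C \<in> inhabited"
    then show "card (traces C m y) \<le> card (traces C n y)"
      using relpow_mono_index[OF _ that]
      by (intro card_mono finite_traces) (auto simp: inhabited_def traces_def)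
  qed
  \<comment> \<open>\<open>Suc b\<close> replaces \<open>b\<close>, by monotonicity in the radius,
    so that \<open>Suc b * n \<ge> n \<ge> c'\<close> even when \<open>b = 0\<close>.\<close>
  have "real (trace_count n x) \<le> real (a * a') * real (trace_count ((b' * Suc b) * n) z)"
    if n: "n \<ge> max c c'" for n
  proof -
    have "n \<ge> c" "Suc b * n \<ge> c'" using n by (auto simp: trans_le_add1)
    have "real (trace_count n x) \<le> real a * real (trace_count (b * n) y)"
      by (rule 1[OF \<open>n \<ge> c\<close>])
    also have "\<dots> \<le> real a * real (trace_count (Suc b * n) y)"
      by (intro mult_left_mono of_nat_mono mono) auto
    also have "\<dots> \<le> real a * (real a' * real (trace_count (b' * (Suc b * n)) z))"
      by (intro mult_left_mono 2[OF \<open>Suc b * n \<ge> c'\<close>]) auto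
    finally show ?thesis by (simp only: of_nat_mult mult.assoc)
  qed
  then show ?thesis
    unfolding trace_dominated_def by blast
qed

text \<open>The ball of radius \<open>n\<close> around \<open>x\<close> lies in the one of radius
  \<open>n + 1\<close> around \<open>y\<close>, and \<open>n + 1 \<le> 2 * n\<close> for
  \<open>n \<ge> 1\<close>.\<close>

lemma trace_dominated_of_plaque_rel:
  assumes "(x, y) \<in> R"
  shows "trace_dominated x y"
proof -
  have "trace_count n x \<le> trace_count (2 * n) y" if "n \<ge> 1" for n
    unfolding trace_count_def
  proof (rule sum_mono)
    fix C assume "C \<in> inhabited"
    have yx: "(y, x) \<in> R" using assms sym_plaque_rel by (rule symD[rotated])
    have "(y, q) \<in> R ^^ (2 * n)" if "(x, q) \<in> R ^^ n" for q
      using relpow_mono_index[OF relpow_Suc_I2[OF yx that]] \<open>n \<ge> 1\<close> by simp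
    then show "card (traces C n x) \<le> card (traces C (2 * n) y)"
      using \<open>C \<in> inhabited\<close>
      by (intro card_mono finite_traces) (auto simp: inhabited_def traces_def)
  qed
  then show ?thesis
    unfolding trace_dominated_def
    by (intro exI[of _ 1] exI[of _ 2] exI[of _ 1]) simp
qed

text \<open>Leaves are the sets reached by finite chains, so closure under single steps makes
  \<open>A\<close> the union of the leaves of its points.\<close>

lemma saturated_if_plaque_rel_closed:
  assumes "\<And>x y. (x, y) \<in> R \<Longrightarrow> x \<in> A \<Longrightarrow> y \<in> A"
  shows "saturated \<A> A"
proof -
  have "y \<in> A" if "(x, y) \<in> R ^^ k" "x \<in> A" for x y k
    using that(1)
  proof (induction k arbitrary: y)
    case (Suc k)
    then obtain p where "(x, p) \<in> R ^^ k" "(p, y) \<in> R" by auto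
    then show ?case using Suc.IH assms by blast
  qed (use that in simp)
  then have "leaf \<A> x \<subseteq> A" if "x \<in> A" for x
    using that in_leaf_iff by blast
  moreover have "x \<in> leaf \<A> x" for x
    unfolding in_leaf_iff by (auto intro: exI[of _ 0])
  ultimately have "A = \<Union>(leaf \<A> ` A)" by blast
  moreover have "leaf \<A> ` A \<subseteq> leaves \<A>"
    by (auto simp: leaves_def leaf_def connected_components_of_def topspace_leaf_topology)
  ultimately show ?thesis unfolding saturated_def by blast
qed

lemma trace_dominated_measurable [measurable]:
  "Measurable.pred (borel \<Otimes>\<^sub>M borel) (\<lambda>p. trace_dominated (fst p) (snd p))"
  unfolding trace_dominated_def by measurable

end

section \<open>A zero-one dichotomy for measurable preorders\<close>

text \<open>Points related by \<open>E\<close> are equivalent for \<open>D\<close>, so by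
  transitivity the sections of \<open>D\<close> and the predicates \<open>A\<close> and
  \<open>B\<close> below are invariant under \<open>E\<close>, and the zero-one hypothesis applies
  to all of them.\<close>

lemma (in finite_measure) zero_one_preorder_dichotomy:
  fixes D E :: "'a \<Rightarrow> 'a \<Rightarrow> bool"
  assumes D_meas: "Measurable.pred (M \<Otimes>\<^sub>M M) (\<lambda>p. D (fst p) (snd p))"
    and D_trans: "\<And>x y z. D x y \<Longrightarrow> D y z \<Longrightarrow> D x z"
    and E_D: "\<And>x y. E x y \<Longrightarrow> D x y \<and> D y x"
    and zero_one: "\<And>P. Measurable.pred M P \<Longrightarrow> (\<And>x y. E x y \<Longrightarrow> P x \<Longrightarrow> P y) \<Longrightarrow>
      (AE x in M. P x) \<or> (AE x in M. \<not> P x)"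
  shows "(\<exists>x. AE y in M. D x y \<and> D y x) \<or> (AE x in M. AE y in M. \<not> (D x y \<or> D y x))"
proof -
  interpret pair_sigma_finite M M ..
  note [measurable] = D_meas
  have D1: "Measurable.pred M (D x)" if "x \<in> space M" for x
    using measurable_compose[OF measurable_Pair1'[OF that] D_meas] by simp
  have D2: "Measurable.pred M (\<lambda>x. D x y)" if "y \<in> space M" for y
    using measurable_compose[OF measurable_Pair2'[OF that] D_meas] by simp
  define A where "A x \<longleftrightarrow> (AE y in M. D x y)" for x
  define B where "B x \<longleftrightarrow> (AE y in M. D y x)" for x
  \<comment> \<open>Fubini: both sides say that \<open>D\<close> holds almost everywhere for the
    product measure.\<close>
  have commute: "(AE x in M. A x) \<longleftrightarrow> (AE x in M. B x)"
    unfolding A_def B_def by (rule AE_commute) measurable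
  \<comment> \<open>\<open>A\<close> and \<open>B\<close> hold where a section of this exceptional
    set is null, and the measure of a section depends measurably on the point.\<close>
  let ?Q = "{p \<in> space (M \<Otimes>\<^sub>M M). \<not> D (fst p) (snd p)}"
  have Q: "?Q \<in> sets (M \<Otimes>\<^sub>M M)" by measurable
  have "A x \<longleftrightarrow> emeasure M (Pair x -` ?Q) = 0" if "x \<in> space M" for x
    unfolding A_def by (intro AE_iff_measurable sets_Pair1[OF Q]) (use that in \<open>auto simp: space_pair_measure\<close>)
  then have "Measurable.pred M A \<longleftrightarrow> Measurable.pred M (\<lambda>x. emeasure M (Pair x -` ?Q) = 0)"
    by (intro measurable_cong) simp
  moreover have "Measurable.pred M (\<lambda>x. emeasure M (Pair x -` ?Q) = 0)"
    using measurable_emeasure_Pair1[OF Q] by measurable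
  moreover have "B y \<longleftrightarrow> emeasure M ((\<lambda>x. (x, y)) -` ?Q) = 0" if "y \<in> space M" for y
    unfolding B_def by (intro AE_iff_measurable sets_Pair2[OF Q]) (use that in \<open>auto simp: space_pair_measure\<close>)
  then have "Measurable.pred M B \<longleftrightarrow> Measurable.pred M (\<lambda>y. emeasure M ((\<lambda>x. (x, y)) -` ?Q) = 0)"
    by (intro measurable_cong) simp
  moreover have "Measurable.pred M (\<lambda>y. emeasure M ((\<lambda>x. (x, y)) -` ?Q) = 0)"
    using measurable_emeasure_Pair2[OF Q] by measurable
  ultimately have "Measurable.pred M A" "Measurable.pred M B"
    by simp_all
  moreover have "A y" if "E x y" "A x" for x y
    using that(2) E_D[OF that(1)] D_trans unfolding A_def by (auto elim!: eventually_mono)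
  moreover have "B y" if "E x y" "B x" for x y
    using that(2) E_D[OF that(1)] D_trans unfolding B_def by (auto elim!: eventually_mono)
  ultimately have "(AE x in M. A x) \<or> (AE x in M. \<not> A x)" "(AE x in M. B x) \<or> (AE x in M. \<not> B x)"
    using zero_one by blast+
  \<comment> \<open>By \<open>commute\<close>, if one of \<open>A\<close>, \<open>B\<close> holds
    almost everywhere then so does the other; no mixed case remains.\<close>
  then consider "AE x in M. A x \<and> B x" | "AE x in M. \<not> A x \<and> \<not> B x"
    using commute by auto
  then show ?thesis
  proof cases
    case 1
    show ?thesis
    proof (cases "\<exists>x. A x \<and> B x")
      case True
      then show ?thesis unfolding A_def B_def by auto
    next
      case False
      \<comment> \<open>Without such a point the measure is zero, and the second alternative holds
        trivially.\<close>
      have "AE x in M. False" using 1 by (rule eventually_mono) (use False in blast)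
      then show ?thesis by (auto elim: eventually_mono)
    qed
  next
    case 2
    have "AE x in M. AE y in M. \<not> (D x y \<or> D y x)"
      using 2 AE_space
    proof eventually_elim
      case (elim x)
      \<comment> \<open>Failure of \<open>A x\<close> says only that \<open>D x y\<close> does not
        hold for almost all \<open>y\<close>; the zero-one law for the section upgrades this to
        failure for almost all \<open>y\<close>.\<close>
      have "(AE y in M. D x y) \<or> (AE y in M. \<not> D x y)"
        using D1 elim(2) E_D D_trans by (intro zero_one) blast+
      moreover have "(AE y in M. D y x) \<or> (AE y in M. \<not> D y x)"
        using D2 elim(2) E_D D_trans by (intro zero_one) blast+
      ultimately show ?case
        using elim(1) unfolding A_def B_def by auto
    qed
    then show ?thesis by blast
  qed
qed

section \<open>Ergodicity and the two alternatives\<close>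

theorem theorem10p14:
  fixes \<A> \<U> :: "('a::{t2_space, second_countable_topology}, real^'n, 'z) chart set"
    and m :: "('a, 'n, 'z) leafwise_section \<Rightarrow> real"
    and \<omega> :: "('a, 'n, 'z) leafwise_section"
    and M :: "'a measure"
  assumes "compact (UNIV :: 'a set)"
    and "foliated_atlas \<A>"
    and "regular_atlas \<A> \<U>"
    and "current \<A> m"
    and "quasi_invariant \<A> m"
    and "positive_density \<A> \<omega>"
    and "represents_current \<A> m \<omega> M"
    and "ergodic \<A> M"
    and "AE x in M. x \<in> holonomy_free_part \<A> \<U>"
  shows "(\<exists>x\<^sub>0. AE x in M. same_growth_type (plaque_growth \<A> \<U> x\<^sub>0) (plaque_growth \<A> \<U> x)) \<or>
    (AE x in M. AE y in M.
       \<not> comparable_growth_types (plaque_growth \<A> \<U> x) (plaque_growth \<A> \<U> y))"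
proof -
  interpret regular_foliated_space \<A> \<U>
    using assms(1-3) by unfold_locales
  have sets_M [measurable_cong]: "sets M = sets borel"
    using assms(7) by (simp add: represents_current_def)
  then have space_M: "space M = UNIV"
    using sets_eq_imp_space_eq by fastforce
  have "emeasure M UNIV < \<infinity>"
    using assms(1,7) by (simp add: represents_current_def)
  then interpret finite_measure M
    by (intro finite_measureI) (simp add: space_M)
  have "(\<exists>x. AE y in M. trace_dominated x y \<and> trace_dominated y x) \<or>
      (AE x in M. AE y in M. \<not> (trace_dominated x y \<or> trace_dominated y x))"
  \<comment> \<open>A measurable predicate invariant under the plaque relation defines a saturated
    set, so ergodicity supplies the zero-one law.\<close>
  proof (rule zero_one_preorder_dichotomy[where E = "\<lambda>x y. (x, y) \<in> R"])
    show "Measurable.pred (M \<Otimes>\<^sub>M M) (\<lambda>p. trace_dominated (fst p) (snd p))"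
      by measurable
    show "trace_dominated x y \<and> trace_dominated y x" if "(x, y) \<in> R" for x y
      using that trace_dominated_of_plaque_rel symD[OF sym_plaque_rel that] by blast
    show "(AE x in M. P x) \<or> (AE x in M. \<not> P x)"
      if "Measurable.pred M P" "\<And>x y. (x, y) \<in> R \<Longrightarrow> P x \<Longrightarrow> P y" for P
    proof -
      have P: "{x. P x} \<in> sets M"
        using that(1) by (simp add: pred_def space_M)
      have compl: "space M - {x. P x} = {x. \<not> P x}"
        by (auto simp: space_M)
      have "saturated \<A> {x. P x}"
        using that(2) by (intro saturated_if_plaque_rel_closed) auto
      then have "emeasure M {x. P x} = 0 \<or> emeasure M (space M - {x. P x}) = 0"
        using assms(8) P unfolding ergodic_def by blast
      then show ?thesis
        using P sets.compl_sets[OF P] unfolding compl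
        by (auto simp: AE_iff_measurable[OF _ refl] space_M)
    qed
  qed (rule trace_dominated_trans)
  then show ?thesis
    by (simp add: same_growth_type_def comparable_growth_types_def dominated_plaque_growth_iff)
qed

end
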